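(* Let $((A,\circ),P)$ and $((A^*,\circ_{A^*}),P^* )$ be averaging pre-Lie algebras, where $P^*$ is the transpose of $P$, and let $\Delta:A\to A\otimes A$ be defined by $\langle\xi\otimes\eta,\Delta(x)\rangle=\langle\xi\circ_{A^*}\eta,x\rangle$. Then the following statements are equivalent: (a) The quintuple $(A,\circ,\Delta,P,P)$ is an averaging pre-Lie bialgebra. (b) $\bigl(((A,\circ),P),((A^*,\circ_{A^*}),P^* ),L_\circ^*-R_\circ^*,-R_\circ^*,L_{\circ_{A^*}}^*-R_{\circ_{A^*}}^*,-R_{\circ_{A^*}}^*\bigr)$ is a matched pair of averaging pre-Lie algebras. (c) $\bigl(((A\oplus A^*,\circ_\star),P\oplus P^*,\omega),((A,\circ),P),((A^*,\circ_{A^*}),P^* )\bigr)$ is a Manin triple of averaging pre-Lie algebras (so that $A$ and $A^*$ are isotropic averaging pre-Lie subalgebras of $A\oplus A^*$), where $$(x+\xi)\circ_\star(y+\eta)=x\circ y+(L_{\circ_{A^*}}^*-R_{\circ_{A^*}}^* )(\xi)y-R_{\circ_{A^*}}^*(\eta)x+\xi\circ_{A^*}\eta+(L_\circ^*-R_\circ^* )(x)\eta-R_\circ^*(y)\xi,$$ $(P\oplus P^* )(x+\xi)=P(x)+P^*(\xi)$ and $\omega(x+\xi,y+\eta)=\langle\xi,y\rangle-\langle\eta,x\rangle$.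
   Context: All vector spaces are finite-dimensional over a fixed field $\mathbf k$ of characteristic $0$; $\langle\cdot,\cdot\rangle$ is the canonical pairing and $\tau(x\otimes y)=y\otimes x$. A pre-Lie algebra $(A,\circ)$ is a vector space with a bilinear product satisfying $(x\circ y)\circ z-x\circ(y\circ z)=(y\circ x)\circ z-y\circ(x\circ z)$. Write $L_\circ(x)y=L_xy=x\circ y$, $R_\circ(x)y=R_xy=y\circ x$. An averaging operator is a linear $P:A\to A$ with $P(x)\circ P(y)=P(P(x)\circ y)=P(x\circ P(y))$; then $((A,\circ),P)$ is an averaging pre-Lie algebra. For a linear map $\rho:A\to\mathrm{End}(V)$, $\rho^*:A\to\mathrm{End}(V^* )$ is defined by $\langle\rho^*(x)v^*,v\rangle=-\langle v^*,\rho(x)v\rangle$. For a single linear map $P$, $P^*$ is the transpose $\langle P^*\xi,x\rangle=\langle\xi,P(x)\rangle$. For maps $A^*\to\mathrm{End}(A^* )$ the dual is taken in $\mathrm{End}(A^{**})=\mathrm{End}(A)$. A pre-Lie coalgebra $(A,\Delta)$ satisfies $(\Delta\otimes\mathrm{id})\Delta-(\mathrm{id}\otimes\Delta)\Delta=(\tau\otimes\mathrm{id})\bigl((\Delta\otimes\mathrm{id})\Delta-(\mathrm{id}\otimes\Delta)\Delta\bigr)$. A pre-Lie bialgebra $(A,\circ,\Delta)$ is a pre-Lie algebra and pre-Lie coalgebra such that for all $x,y$: $\Delta(x\circ y-y\circ x)=(L_x\otimes\mathrm{id}+\mathrm{id}\otimes(L_x-R_x))\Delta(y)-(L_y\otimes\mathrm{id}+\mathrm{id}\otimes(L_y-R_y))\Delta(x)$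 and $(\mathrm{id}-\tau)\Delta(x\circ y)=(\mathrm{id}-\tau)\bigl[(\mathrm{id}\otimes R_y)\Delta(x)+(L_x\otimes\mathrm{id}+\mathrm{id}\otimes L_x)\Delta(y)\bigr]$. An averaging pre-Lie coalgebra $((A,\Delta),S)$ is a pre-Lie coalgebra with linear $S:A\to A$ such that $(S\otimes S)\Delta(x)=(S\otimes\mathrm{id})\Delta(S(x))=(\mathrm{id}\otimes S)\Delta(S(x))$. An averaging pre-Lie bialgebra is a quintuple $(A,\circ,\Delta,P,S)$ such that $((A,\circ),P)$ is an averaging pre-Lie algebra, $((A,\Delta),S)$ is an averaging pre-Lie coalgebra, $(A,\circ,\Delta)$ is a pre-Lie bialgebra, and for all $x,y\in A$: $P(x)\circ S(y)=S(P(x)\circ y)=S(x\circ S(y))$; $S(x)\circ P(y)=S(x\circ P(y))=S(S(x)\circ y)$; $(P\otimes S)\Delta(x)=(\mathrm{id}\otimes S)\Delta(P(x))=(P\otimes\mathrm{id})\Delta(P(x))$; $(S\otimes P)\Delta(x)=(S\otimes\mathrm{id})\Delta(P(x))=(\mathrm{id}\otimes P)\Delta(P(x))$. A representation of $(A,\circ)$ is $(V,\rho,\varphi)$ with linear $\rho,\varphi:A\to\mathrm{End}(V)$ such that $\rho(x\circ y-y\circ x)=\rho(x)\rho(y)-\rho(y)\rho(x)$ and $\varphi(x\circ y)=\rho(x)\varphi(y)-\varphi(y)\rho(x)+\varphi(y)\varphi(x)$. A representation of $((A,\circ),P)$ is $((V,\rho,\varphi),\alpha)$ with $(V,\rho,\varphi)$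 a representation of $(A,\circ)$ and $\alpha:V\to V$ linear such that $\rho(P(x))\alpha(v)=\alpha(\rho(P(x))v)=\alpha(\rho(x)\alpha(v))$ and $\varphi(P(x))\alpha(v)=\alpha(\varphi(P(x))v)=\alpha(\varphi(x)\alpha(v))$. A matched pair of averaging pre-Lie algebras is a sextuple $(((A,\circ_A),P_A),((\mathfrak b,\circ_{\mathfrak b}),P_{\mathfrak b}),\rho_A,\varphi_A,\rho_{\mathfrak b},\varphi_{\mathfrak b})$ where the first two entries are averaging pre-Lie algebras, $((\mathfrak b,\rho_A,\varphi_A),P_{\mathfrak b})$ is a representation of $((A,\circ_A),P_A)$, $((A,\rho_{\mathfrak b},\varphi_{\mathfrak b}),P_A)$ is a representation of $((\mathfrak b,\circ_{\mathfrak b}),P_{\mathfrak b})$, and for all $x,y\in A$, $a,b\in\mathfrak b$: $\rho_A(x)(a\circ_{\mathfrak b}b)=-\rho_A(\rho_{\mathfrak b}(a)x-\varphi_{\mathfrak b}(a)x)b+(\rho_A(x)a-\varphi_A(x)a)\circ_{\mathfrak b}b+\varphi_A(\varphi_{\mathfrak b}(b)x)a+a\circ_{\mathfrak b}(\rho_A(x)b)$, $\varphi_A(x)(a\circ_{\mathfrak b}b-b\circ_{\mathfrak b}a)=\varphi_A(\rho_{\mathfrak b}(b)x)a-\varphi_A(\rho_{\mathfrak b}(a)x)b+a\circ_{\mathfrak b}(\varphi_A(x)b)-b\circ_{\mathfrak b}(\varphi_A(x)a)$, $\rho_{\mathfrak b}(a)(x\circ_Ay)=-\rho_{\mathfrak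 b}(\rho_A(x)a-\varphi_A(x)a)y+(\rho_{\mathfrak b}(a)x-\varphi_{\mathfrak b}(a)x)\circ_Ay+\varphi_{\mathfrak b}(\varphi_A(y)a)x+x\circ_A(\rho_{\mathfrak b}(a)y)$, $\varphi_{\mathfrak b}(a)(x\circ_Ay-y\circ_Ax)=\varphi_{\mathfrak b}(\rho_A(y)a)x-\varphi_{\mathfrak b}(\rho_A(x)a)y+x\circ_A(\varphi_{\mathfrak b}(a)y)-y\circ_A(\varphi_{\mathfrak b}(a)x)$. A quadratic averaging pre-Lie algebra $((A,\circ),P,\omega)$ is an averaging pre-Lie algebra with a nondegenerate skew-symmetric bilinear form $\omega$ such that $\omega(x\circ y,z)+\omega(y,x\circ z-z\circ x)=0$ and $\omega(Px,y)=\omega(x,Py)$. A Manin triple of averaging pre-Lie algebras $\bigl(((\mathcal A,\circ_{\mathcal A}),\mathcal P,\omega),((A,\circ_A),P_A),((\mathfrak b,\circ_{\mathfrak b}),P_{\mathfrak b})\bigr)$ consists of an even-dimensional quadratic averaging pre-Lie algebra and pre-Lie subalgebras $A,\mathfrak b\subset\mathcal A$ with $\mathcal P|_A=P_A$, $\mathcal P|_{\mathfrak b}=P_{\mathfrak b}$, both isotropic for $\omega$, with $\mathcal A=A\oplus\mathfrak b$ as vector spaces. *)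

theory Defs
  imports Complex_Main "HOL-Library.Function_Algebras" "HOL-Library.Product_Plus"
begin

section \<open>Finite-dimensional vector spaces and duals\<close>

text \<open>
  A finite-dimensional vector space is a subspace \<open>V\<close> of an ambient type carrying a
  \<open>vector_space\<close> structure.  The basic space \<open>A\<close> of the development is a whole type
  (\<open>V = UNIV\<close>), its dual is the set of linear functionals inside \<open>'a \<Rightarrow> 'k\<close>, and
  \<open>A \<oplus> A*\<close> is a set of pairs.  All laws are required on the carrier only.
\<close>

locale fd_space = vector_space scale
  for scale :: "'k::field_char_0 \<Rightarrow> 'v::ab_group_add \<Rightarrow> 'v" +
  fixes V :: "'v set"
  assumes finite_dim: "\<exists>B. finite B \<and> span B = V"

definition linear_on ::
  "('k \<Rightarrow> 'v::plus \<Rightarrow> 'v) \<Rightarrow> ('k \<Rightarrow> 'w::plus \<Rightarrow> 'w) \<Rightarrow> 'v set \<Rightarrow> 'w set \<Rightarrow> ('v \<Rightarrow> 'w) \<Rightarrow> bool"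
  where "linear_on sV sW V W f \<longleftrightarrow>
    (\<forall>x\<in>V. f x \<in> W) \<and>
    (\<forall>x\<in>V. \<forall>y\<in>V. f (x + y) = f x + f y) \<and>
    (\<forall>c. \<forall>x\<in>V. f (sV c x) = sW c (f x))"

definition bilinear_on ::
  "('k \<Rightarrow> 'u::plus \<Rightarrow> 'u) \<Rightarrow> ('k \<Rightarrow> 'v::plus \<Rightarrow> 'v) \<Rightarrow> ('k \<Rightarrow> 'w::plus \<Rightarrow> 'w) \<Rightarrow>
    'u set \<Rightarrow> 'v set \<Rightarrow> 'w set \<Rightarrow> ('u \<Rightarrow> 'v \<Rightarrow> 'w) \<Rightarrow> bool"
  where "bilinear_on sU sV sW U V W f \<longleftrightarrow>
    (\<forall>x\<in>U. linear_on sV sW V W (f x)) \<and>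
    (\<forall>y\<in>V. linear_on sU sW U W (\<lambda>x. f x y))"

definition fun_scale :: "('k \<Rightarrow> 'w \<Rightarrow> 'w) \<Rightarrow> 'k \<Rightarrow> ('x \<Rightarrow> 'w) \<Rightarrow> 'x \<Rightarrow> 'w"
  where "fun_scale s c f = (\<lambda>x. s c (f x))"

definition prod_scale :: "('k \<Rightarrow> 'v \<Rightarrow> 'v) \<Rightarrow> ('k \<Rightarrow> 'w \<Rightarrow> 'w) \<Rightarrow> 'k \<Rightarrow> 'v \<times> 'w \<Rightarrow> 'v \<times> 'w"
  where "prod_scale s t c p = (s c (fst p), t c (snd p))"

abbreviation dual_scale :: "'k::times \<Rightarrow> ('v \<Rightarrow> 'k) \<Rightarrow> 'v \<Rightarrow> 'k"
  where "dual_scale \<equiv> fun_scale (*)"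

definition dual :: "('k::field \<Rightarrow> 'v::ab_group_add \<Rightarrow> 'v) \<Rightarrow> ('v \<Rightarrow> 'k) set"
  where "dual scale = {\<xi>. Vector_Spaces.linear scale (*) \<xi>}"

definition transpose_map :: "('v \<Rightarrow> 'v) \<Rightarrow> ('v \<Rightarrow> 'k) \<Rightarrow> 'v \<Rightarrow> 'k"
  where "transpose_map P \<xi> = (\<lambda>x. \<xi> (P x))"

definition left_mult :: "('v \<Rightarrow> 'v \<Rightarrow> 'v) \<Rightarrow> 'v \<Rightarrow> 'v \<Rightarrow> 'v"
  where "left_mult mul x y = mul x y"

definition right_mult :: "('v \<Rightarrow> 'v \<Rightarrow> 'v) \<Rightarrow> 'v \<Rightarrow> 'v \<Rightarrow> 'v"
  where "right_mult mul x y = mul y x"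

definition dual_rep :: "('x \<Rightarrow> 'v \<Rightarrow> 'v) \<Rightarrow> 'x \<Rightarrow> ('v \<Rightarrow> 'k::uminus) \<Rightarrow> 'v \<Rightarrow> 'k"
  where "dual_rep \<rho> x \<xi> = (\<lambda>v. - \<xi> (\<rho> x v))"

text \<open>
  For \<open>\<rho> : A* \<rightarrow> End(A*)\<close> the dual map takes values in \<open>End(A**)\<close>.  Under \<open>A** = A\<close> the vector
  \<open>\<rho>*(\<xi>) x\<close> is the one representing the functional \<open>\<eta> \<mapsto> - \<langle>x, \<rho>(\<xi>) \<eta>\<rangle>\<close> on \<open>A*\<close>; it exists and is
  unique because \<open>A\<close> is finite-dimensional.
\<close>

definition codual_rep ::
  "('k::field \<Rightarrow> 'a::ab_group_add \<Rightarrow> 'a) \<Rightarrow> ('x \<Rightarrow> ('a \<Rightarrow> 'k) \<Rightarrow> 'a \<Rightarrow> 'k) \<Rightarrow> 'x \<Rightarrow> 'a \<Rightarrow> 'a"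
  where "codual_rep scale \<rho> \<xi> x = (THE y. \<forall>\<eta>\<in>dual scale. \<eta> y = - \<rho> \<xi> \<eta> x)"


section \<open>Tensor powers of a vector space\<close>

text \<open>
  The tensor \<open>x \<otimes> y\<close> is realised by its values \<open>\<langle>\<xi> \<otimes> \<eta>, x \<otimes> y\<rangle> = \<langle>\<xi>, x\<rangle> \<langle>\<eta>, y\<rangle>\<close> on pairs of
  functionals (and 0 outside the dual, so that equality of tensors is equality in HOL), and
  \<open>A \<otimes> A\<close> is the span of these; likewise for \<open>A \<otimes> A \<otimes> A\<close>.  Accordingly \<open>\<langle>\<xi> \<otimes> \<eta>, t\<rangle>\<close> is
  \<open>t \<xi> \<eta>\<close>.  Over a field this is a tensor product: see the universal property below.
\<close>

type_synonym ('a, 'k) tensor2 = "('a \<Rightarrow> 'k) \<Rightarrow> ('a \<Rightarrow> 'k) \<Rightarrow> 'k"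
type_synonym ('a, 'k) tensor3 = "('a \<Rightarrow> 'k) \<Rightarrow> ('a \<Rightarrow> 'k) \<Rightarrow> ('a \<Rightarrow> 'k) \<Rightarrow> 'k"

abbreviation tensor2_scale :: "'k::times \<Rightarrow> ('a, 'k) tensor2 \<Rightarrow> ('a, 'k) tensor2"
  where "tensor2_scale \<equiv> fun_scale (fun_scale (*))"

definition pure2 :: "('k::field \<Rightarrow> 'a::ab_group_add \<Rightarrow> 'a) \<Rightarrow> 'a \<Rightarrow> 'a \<Rightarrow> ('a, 'k) tensor2"
  where "pure2 scale x y =
    (\<lambda>\<xi> \<eta>. if \<xi> \<in> dual scale \<and> \<eta> \<in> dual scale then \<xi> x * \<eta> y else 0)"

definition pure3 :: "('k::field \<Rightarrow> 'a::ab_group_add \<Rightarrow> 'a) \<Rightarrow> 'a \<Rightarrow> 'a \<Rightarrow> 'a \<Rightarrow> ('a, 'k) tensor3"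
  where "pure3 scale x y z =
    (\<lambda>\<xi> \<eta> \<zeta>. if \<xi> \<in> dual scale \<and> \<eta> \<in> dual scale \<and> \<zeta> \<in> dual scale
      then \<xi> x * \<eta> y * \<zeta> z else 0)"

definition tensor2 :: "('k::field \<Rightarrow> 'a::ab_group_add \<Rightarrow> 'a) \<Rightarrow> ('a, 'k) tensor2 set"
  where "tensor2 scale = module.span tensor2_scale {pure2 scale x y | x y. True}"

definition tensor_pairing :: "('a \<Rightarrow> 'k) \<Rightarrow> ('a \<Rightarrow> 'k) \<Rightarrow> ('a, 'k) tensor2 \<Rightarrow> 'k"
  where "tensor_pairing \<xi> \<eta> t = t \<xi> \<eta>"

text \<open>The map \<open>f \<otimes> g\<close> on \<open>A \<otimes> A\<close>, characterised by \<open>tensor_map_pure2\<close> below.\<close>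

definition tensor_map ::
  "('k::field \<Rightarrow> 'a::ab_group_add \<Rightarrow> 'a) \<Rightarrow> ('a \<Rightarrow> 'a) \<Rightarrow> ('a \<Rightarrow> 'a) \<Rightarrow>
    ('a, 'k) tensor2 \<Rightarrow> ('a, 'k) tensor2"
  where "tensor_map scale f g t =
    (\<lambda>\<xi> \<eta>. if \<xi> \<in> dual scale \<and> \<eta> \<in> dual scale
      then t (\<lambda>x. \<xi> (f x)) (\<lambda>y. \<eta> (g y)) else 0)"

definition flip :: "('a, 'k) tensor2 \<Rightarrow> ('a, 'k) tensor2"
  where "flip t = (\<lambda>\<xi> \<eta>. t \<eta> \<xi>)"

text \<open>The maps \<open>\<Delta> \<otimes> id\<close> and \<open>id \<otimes> \<Delta>\<close> from \<open>A \<otimes> A\<close> to \<open>A \<otimes> A \<otimes> A\<close>, and \<open>\<tau> \<otimes> id\<close>.\<close>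

definition coprod_left ::
  "('k::field \<Rightarrow> 'a::ab_group_add \<Rightarrow> 'a) \<Rightarrow> ('a \<Rightarrow> ('a, 'k) tensor2) \<Rightarrow>
    ('a, 'k) tensor2 \<Rightarrow> ('a, 'k) tensor3"
  where "coprod_left scale \<Delta> t =
    (\<lambda>\<xi> \<eta> \<zeta>. if \<xi> \<in> dual scale \<and> \<eta> \<in> dual scale \<and> \<zeta> \<in> dual scale
      then t (\<lambda>x. \<Delta> x \<xi> \<eta>) \<zeta> else 0)"

definition coprod_right ::
  "('k::field \<Rightarrow> 'a::ab_group_add \<Rightarrow> 'a) \<Rightarrow> ('a \<Rightarrow> ('a, 'k) tensor2) \<Rightarrow>
    ('a, 'k) tensor2 \<Rightarrow> ('a, 'k) tensor3"
  where "coprod_right scale \<Delta> t =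
    (\<lambda>\<xi> \<eta> \<zeta>. if \<xi> \<in> dual scale \<and> \<eta> \<in> dual scale \<and> \<zeta> \<in> dual scale
      then t \<xi> (\<lambda>y. \<Delta> y \<eta> \<zeta>) else 0)"

definition flip12 :: "('a, 'k) tensor3 \<Rightarrow> ('a, 'k) tensor3"
  where "flip12 t = (\<lambda>\<xi> \<eta> \<zeta>. t \<eta> \<xi> \<zeta>)"


subsection \<open>Justification of the tensor construction\<close>

lemma sum_apply: "(\<Sum>i\<in>I. f i) x = (\<Sum>i\<in>I. f i x)"
  by (induction I rule: infinite_finite_induct) auto

lemma vector_space_fun_scale:
  assumes "vector_space s"
  shows "vector_space (fun_scale s :: 'k::field \<Rightarrow> ('x \<Rightarrow> 'w::ab_group_add) \<Rightarrow> 'x \<Rightarrow> 'w)"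
proof -
  interpret vector_space s by fact
  show ?thesis
    by unfold_locales (auto simp: fun_scale_def scale_left_distrib scale_right_distrib)
qed

lemma vector_space_mult: "vector_space ((*) :: 'k::field \<Rightarrow> 'k \<Rightarrow> 'k)"
  by unfold_locales (auto simp: algebra_simps)

lemma vector_space_tensor2:
  "vector_space (tensor2_scale :: 'k::field \<Rightarrow> ('a, 'k) tensor2 \<Rightarrow> ('a, 'k) tensor2)"
  by (intro vector_space_fun_scale vector_space_mult)

lemma dual_iff:
  fixes scale :: "'k::field \<Rightarrow> 'a::ab_group_add \<Rightarrow> 'a"
  assumes "vector_space scale"
  shows "\<xi> \<in> dual scale \<longleftrightarrow> (\<forall>x y. \<xi> (x + y) = \<xi> x + \<xi> y) \<and> (\<forall>c x. \<xi> (scale c x) = c * \<xi> x)"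
proof -
  interpret vector_space scale by fact
  show ?thesis
    unfolding dual_def linear_iff_module_hom module_hom_iff mem_Collect_eq
    using module_axioms vector_space_mult[THEN module_iff_vector_space[THEN iffD2]] by auto
qed

lemma tensor_map_pure2:
  fixes scale :: "'k::field \<Rightarrow> 'a::ab_group_add \<Rightarrow> 'a"
  assumes "vector_space scale" "linear_on scale scale UNIV UNIV f" "linear_on scale scale UNIV UNIV g"
  shows "tensor_map scale f g (pure2 scale x y) = pure2 scale (f x) (g y)"
  using assms(2,3)
  by (auto simp: tensor_map_def pure2_def linear_on_def dual_iff[OF assms(1)] fun_eq_iff)

lemma flip_pure2: "flip (pure2 scale x y) = pure2 scale y x"
  by (auto simp: flip_def pure2_def fun_eq_iff)

lemma flip12_pure3: "flip12 (pure3 scale x y z) = pure3 scale y x z"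
  by (auto simp: flip12_def pure3_def fun_eq_iff)

lemma coprod_pure2:
  fixes scale :: "'k::field \<Rightarrow> 'a::ab_group_add \<Rightarrow> 'a"
  assumes "vector_space scale" "linear_on scale tensor2_scale UNIV (tensor2 scale) \<Delta>"
  shows "\<Delta> x = (\<Sum>i\<in>I. pure2 scale (a i) (b i)) \<Longrightarrow>
      coprod_left scale \<Delta> (pure2 scale x y) = (\<Sum>i\<in>I. pure3 scale (a i) (b i) y)" (is "?p \<Longrightarrow> ?P")
    and "\<Delta> y = (\<Sum>i\<in>I. pure2 scale (a i) (b i)) \<Longrightarrow>
      coprod_right scale \<Delta> (pure2 scale x y) = (\<Sum>i\<in>I. pure3 scale x (a i) (b i))" (is "?q \<Longrightarrow> ?Q")
proof -
  have d: "(\<lambda>x. \<Delta> x \<xi> \<eta>) \<in> dual scale" for \<xi> \<eta>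
    using assms(2) unfolding dual_iff[OF assms(1)] by (auto simp: linear_on_def fun_scale_def)
  show "?p \<Longrightarrow> ?P" "?q \<Longrightarrow> ?Q"
    using d by (auto simp: fun_eq_iff coprod_left_def coprod_right_def pure2_def pure3_def sum_apply
        sum_distrib_left sum_distrib_right mult.assoc)
qed

lemma tensor2_outside_dual:
  fixes scale :: "'k::field \<Rightarrow> 'a::ab_group_add \<Rightarrow> 'a"
  assumes "t \<in> tensor2 scale" "\<xi> \<notin> dual scale \<or> \<eta> \<notin> dual scale"
  shows "t \<xi> \<eta> = 0"
proof -
  interpret t2: vector_space "tensor2_scale :: 'k \<Rightarrow> ('a, 'k) tensor2 \<Rightarrow> _"
    by (rule vector_space_tensor2)
  show ?thesis
    using assms(1) unfolding tensor2_def
    by (induction rule: t2.span_induct_alt) (use assms(2) in \<open>auto simp: pure2_def fun_scale_def\<close>)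
qed

lemma pure2_in_tensor2:
  fixes scale :: "'k::field \<Rightarrow> 'a::ab_group_add \<Rightarrow> 'a"
  shows "pure2 scale x y \<in> tensor2 scale"
proof -
  interpret t2: vector_space "tensor2_scale :: 'k \<Rightarrow> ('a, 'k) tensor2 \<Rightarrow> _"
    by (rule vector_space_tensor2)
  show ?thesis unfolding tensor2_def by (rule t2.span_base) blast
qed

context finite_dimensional_vector_space
begin

lemma coord_in_dual: "(\<lambda>x. representation Basis x b) \<in> dual scale"
  unfolding dual_iff[OF vector_space_axioms]
  by (simp add: representation_add representation_scale independent_Basis span_Basis)

lemma basis_expansion: "(\<Sum>b\<in>Basis. scale (representation Basis x b) b) = x"
  by (rule sum_representation_eq) (auto simp: independent_Basis span_Basis finite_Basis)

lemma dual_sum: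
  assumes "\<xi> \<in> dual scale"
  shows "\<xi> (\<Sum>i\<in>I. scale (c i) (v i)) = (\<Sum>i\<in>I. c i * \<xi> (v i))"
proof -
  have "\<xi> 0 = 0" using assms unfolding dual_iff[OF vector_space_axioms]
    by (metis add_cancel_right_left add.right_neutral)
  then show ?thesis using assms unfolding dual_iff[OF vector_space_axioms]
    by (induction I rule: infinite_finite_induct) auto
qed

lemma dual_expansion:
  assumes "\<xi> \<in> dual scale"
  shows "\<xi> = (\<Sum>b\<in>Basis. dual_scale (\<xi> b) (\<lambda>x. representation Basis x b))"
proof
  fix x
  have "\<xi> x = \<xi> (\<Sum>b\<in>Basis. scale (representation Basis x b) b)" by (simp only: basis_expansion)
  then show "\<xi> x = (\<Sum>b\<in>Basis. dual_scale (\<xi> b) (\<lambda>x. representation Basis x b)) x"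
    by (simp add: dual_sum[OF assms] sum_apply fun_scale_def mult.commute)
qed

lemma linear_on_dual_sum:
  assumes "linear_on dual_scale (*) (dual scale) UNIV f" "finite I" "\<And>i. i \<in> I \<Longrightarrow> \<xi> i \<in> dual scale"
  shows "f (\<Sum>i\<in>I. dual_scale (c i) (\<xi> i)) = (\<Sum>i\<in>I. c i * f (\<xi> i))"
proof -
  have z: "0 \<in> dual scale" and
    sc: "\<And>c \<xi>. \<xi> \<in> dual scale \<Longrightarrow> dual_scale c \<xi> \<in> dual scale" and
    ad: "\<And>\<xi> \<eta>. \<xi> \<in> dual scale \<Longrightarrow> \<eta> \<in> dual scale \<Longrightarrow> \<xi> + \<eta> \<in> dual scale"
    unfolding dual_iff[OF vector_space_axioms] by (auto simp: fun_scale_def algebra_simps)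
  have "f (0 + 0) = f 0 + f 0" using assms(1) z unfolding linear_on_def by blast
  then have f0: "f 0 = 0" by (metis add.right_neutral add_left_cancel)
  have "(\<Sum>i\<in>I. dual_scale (c i) (\<xi> i)) \<in> dual scale \<and> ?thesis"
    using assms(2,3)
  proof (induction I rule: finite_induct)
    case empty
    then show ?case using z f0 by (simp add: zero_fun_def)
  next
    case (insert i I)
    then show ?case using assms(1) sc ad unfolding linear_on_def by (simp del: plus_fun_apply)
  qed
  then show ?thesis by blast
qed

lemma bilinear_dual_expansion:
  assumes "bilinear_on dual_scale dual_scale (*) (dual scale) (dual scale) UNIV t"
    and "\<xi> \<in> dual scale" "\<eta> \<in> dual scale"
  shows "t \<xi> \<eta> = (\<Sum>b\<in>Basis. \<Sum>c\<in>Basis.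
    \<xi> b * \<eta> c * t (\<lambda>x. representation Basis x b) (\<lambda>x. representation Basis x c))"
proof -
  let ?r = "\<lambda>b x. representation Basis x b"
  have "t \<xi> \<eta> = t (\<Sum>b\<in>Basis. dual_scale (\<xi> b) (?r b)) \<eta>"
    by (subst dual_expansion[OF assms(2)]) simp
  also have "\<dots> = (\<Sum>b\<in>Basis. \<xi> b * t (?r b) \<eta>)"
    using assms(1,3) by (intro linear_on_dual_sum)
      (auto simp: bilinear_on_def coord_in_dual finite_Basis)
  also have "\<dots> = (\<Sum>b\<in>Basis. \<xi> b * t (?r b) (\<Sum>c\<in>Basis. dual_scale (\<eta> c) (?r c)))"
    by (subst dual_expansion[OF assms(3)]) simp
  also have "\<dots> = (\<Sum>b\<in>Basis. \<xi> b * (\<Sum>c\<in>Basis. \<eta> c * t (?r b) (?r c)))"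
    using assms(1) by (intro sum.cong refl arg_cong2[where f = "(*)"] linear_on_dual_sum)
      (auto simp: bilinear_on_def coord_in_dual finite_Basis)
  finally show ?thesis by (simp add: sum_distrib_left mult.assoc)
qed

text \<open>
  In finite dimension every bilinear form on the dual is a tensor; in particular the coproduct
  dual to a bilinear product on the dual exists.
\<close>

theorem tensor2_eq_bilinear:
  "tensor2 scale = {t. bilinear_on dual_scale dual_scale (*) (dual scale) (dual scale) UNIV t \<and>
    (\<forall>\<xi> \<eta>. \<xi> \<notin> dual scale \<or> \<eta> \<notin> dual scale \<longrightarrow> t \<xi> \<eta> = 0)}" (is "_ = ?B")
proof (intro equalityI subsetI)
  interpret t2: vector_space "tensor2_scale :: 'a \<Rightarrow> ('b, 'a) tensor2 \<Rightarrow> _"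
    by (rule vector_space_tensor2)
  fix t
  {
    assume t: "t \<in> tensor2 scale"
    have ad: "\<And>\<xi> \<eta>. \<xi> \<in> dual scale \<Longrightarrow> \<eta> \<in> dual scale \<Longrightarrow> (\<lambda>x. \<xi> x + \<eta> x) \<in> dual scale"
      and sc: "\<And>c \<xi>. \<xi> \<in> dual scale \<Longrightarrow> (\<lambda>x. c * \<xi> x) \<in> dual scale"
      unfolding dual_iff[OF vector_space_axioms] by (auto simp: algebra_simps)
    have "bilinear_on dual_scale dual_scale (*) (dual scale) (dual scale) UNIV t"
      using t unfolding tensor2_def
    proof (induction rule: t2.span_induct_alt)
      case base
      then show ?case by (simp add: bilinear_on_def linear_on_def)
    next
      case (step c u v)
      then obtain x y where u: "u = pure2 scale x y" by blast
      have "bilinear_on dual_scale dual_scale (*) (dual scale) (dual scale) UNIV u"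
        unfolding u pure2_def bilinear_on_def linear_on_def plus_fun_def fun_scale_def
        using ad sc by (auto simp: algebra_simps)
      with step(2) show ?case
        by (simp add: bilinear_on_def linear_on_def algebra_simps fun_scale_def)
    qed
    then show "t \<in> ?B" using tensor2_outside_dual[OF t] by blast
  next
    assume t: "t \<in> ?B"
    let ?r = "\<lambda>b x. representation Basis x b"
    have "t = (\<Sum>b\<in>Basis. \<Sum>c\<in>Basis. tensor2_scale (t (?r b) (?r c)) (pure2 scale b c))"
    proof (intro ext)
      fix \<xi> \<eta>
      show "t \<xi> \<eta> = (\<Sum>b\<in>Basis. \<Sum>c\<in>Basis. tensor2_scale (t (?r b) (?r c)) (pure2 scale b c)) \<xi> \<eta>"
      proof (cases "\<xi> \<in> dual scale \<and> \<eta> \<in> dual scale")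
        case True
        then show ?thesis
          using t bilinear_dual_expansion[of t \<xi> \<eta>]
          by (simp add: sum_apply fun_scale_def pure2_def mult_ac)
      next
        case False
        then have "t \<xi> \<eta> = 0" "pure2 scale b c \<xi> \<eta> = 0" for b c
          using t by (auto simp: pure2_def)
        then show ?thesis by (simp add: sum_apply fun_scale_def)
      qed
    qed
    also have "\<dots> \<in> tensor2 scale"
      unfolding tensor2_def by (intro t2.span_sum t2.span_scale t2.span_base) blast
    finally show "t \<in> tensor2 scale" .
  }
qed

theorem tensor2_universal:
  fixes s :: "'a \<Rightarrow> 'w::ab_group_add \<Rightarrow> 'w"
  assumes "vector_space s" "bilinear_on scale scale s UNIV UNIV UNIV \<beta>"
  shows "\<exists>h. linear_on tensor2_scale s (tensor2 scale) UNIV h \<and> (\<forall>x y. h (pure2 scale x y) = \<beta> x y)"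
    and "linear_on tensor2_scale s (tensor2 scale) UNIV h \<Longrightarrow>
      linear_on tensor2_scale s (tensor2 scale) UNIV h' \<Longrightarrow>
      (\<And>x y. h (pure2 scale x y) = h' (pure2 scale x y)) \<Longrightarrow> t \<in> tensor2 scale \<Longrightarrow> h t = h' t"
proof -
  interpret w: vector_space s by fact
  interpret t2: vector_space "tensor2_scale :: 'a \<Rightarrow> ('b, 'a) tensor2 \<Rightarrow> _"
    by (rule vector_space_tensor2)
  let ?r = "\<lambda>b x. representation Basis x b"
  let ?h = "\<lambda>t :: ('b, 'a) tensor2. \<Sum>b\<in>Basis. \<Sum>c\<in>Basis. s (t (?r b) (?r c)) (\<beta> b c)"
  have add: "\<beta> (x + x') y = \<beta> x y + \<beta> x' y" "\<beta> x (y + y') = \<beta> x y + \<beta> x y'"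
    and sc: "\<beta> (scale c x) y = s c (\<beta> x y)" "\<beta> x (scale c y) = s c (\<beta> x y)" for c x x' y y'
    using assms(2) by (auto simp: bilinear_on_def linear_on_def)
  have zero: "\<beta> 0 y = 0" "\<beta> x 0 = 0" for x y
    using sc(1)[of 0 0 y] sc(2)[of x 0 0] by auto
  have sum1: "\<beta> (\<Sum>i\<in>I. v i) y = (\<Sum>i\<in>I. \<beta> (v i) y)" for I y and v :: "'b \<Rightarrow> 'b"
    by (induction I rule: infinite_finite_induct) (auto simp: add zero)
  have sum2: "\<beta> x (\<Sum>i\<in>I. v i) = (\<Sum>i\<in>I. \<beta> x (v i))" for I x and v :: "'b \<Rightarrow> 'b"
    by (induction I rule: infinite_finite_induct) (auto simp: add zero)
  have "?h (pure2 scale x y) = \<beta> x y" for x y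
  proof -
    have "\<beta> x y = \<beta> (\<Sum>b\<in>Basis. scale (?r b x) b) (\<Sum>c\<in>Basis. scale (?r c y) c)"
      by (simp only: basis_expansion)
    also have "\<dots> = (\<Sum>b\<in>Basis. \<Sum>c\<in>Basis. s (?r b x * ?r c y) (\<beta> b c))"
      unfolding sum1 by (simp add: sum2 sc w.scale_sum_right mult.commute)
    finally show ?thesis by (simp add: pure2_def coord_in_dual)
  qed
  moreover have "linear_on tensor2_scale s (tensor2 scale) UNIV ?h"
    by (simp add: linear_on_def fun_scale_def w.scale_left_distrib sum.distrib w.scale_sum_right)
  ultimately show "\<exists>h. linear_on tensor2_scale s (tensor2 scale) UNIV h \<and>
      (\<forall>x y. h (pure2 scale x y) = \<beta> x y)" by blast
  assume h: "linear_on tensor2_scale s (tensor2 scale) UNIV h"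
    and h': "linear_on tensor2_scale s (tensor2 scale) UNIV h'"
    and eq: "\<And>x y. h (pure2 scale x y) = h' (pure2 scale x y)"
    and t: "t \<in> tensor2 scale"
  have z: "0 \<in> tensor2 scale" unfolding tensor2_def by (rule t2.span_zero)
  have h0: "h 0 = 0" "h' 0 = 0"
    using h h' z unfolding linear_on_def by (metis add_cancel_right_left add.right_neutral)+
  from t have "t \<in> tensor2 scale \<and> h t = h' t" unfolding tensor2_def
  proof (induction rule: t2.span_induct_alt)
    case base
    show ?case using h0 z unfolding tensor2_def by metis
  next
    case (step c u v)
    then obtain x y where u: "u = pure2 scale x y" by blast
    have uT: "u \<in> tensor2 scale" unfolding u by (rule pure2_in_tensor2)
    then have cuT: "tensor2_scale c u \<in> tensor2 scale"
      unfolding tensor2_def by (rule t2.span_scale)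
    have vT: "v \<in> tensor2 scale" and hv: "h v = h' v" using step by (simp_all add: tensor2_def)
    have "h (tensor2_scale c u + v) = s c (h u) + h v" "h' (tensor2_scale c u + v) = s c (h' u) + h' v"
      using h h' uT cuT vT unfolding linear_on_def by simp_all
    then have "h (tensor2_scale c u + v) = h' (tensor2_scale c u + v)"
      by (simp only: hv u eq)
    moreover have "tensor2_scale c u + v \<in> tensor2 scale"
      using uT vT unfolding tensor2_def by (intro t2.span_add t2.span_scale)
    ultimately show ?case unfolding tensor2_def by metis
  qed
  then show "h t = h' t" by blast
qed

end


section \<open>Averaging pre-Lie algebras, representations, matched pairs\<close>

locale pre_lie_algebra = fd_space scale V
  for scale :: "'k::field_char_0 \<Rightarrow> 'v::ab_group_add \<Rightarrow> 'v" and V +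
  fixes mul :: "'v \<Rightarrow> 'v \<Rightarrow> 'v"  (infixl "\<odot>" 70)
  assumes mul_bilinear: "bilinear_on scale scale scale V V V mul"
    and pre_lie: "\<And>x y z. x \<in> V \<Longrightarrow> y \<in> V \<Longrightarrow> z \<in> V \<Longrightarrow>
      (x \<odot> y) \<odot> z - x \<odot> (y \<odot> z) = (y \<odot> x) \<odot> z - y \<odot> (x \<odot> z)"

locale averaging_pre_lie_algebra = pre_lie_algebra scale V mul
  for scale :: "'k::field_char_0 \<Rightarrow> 'v::ab_group_add \<Rightarrow> 'v" and V and mul  (infixl "\<odot>" 70) +
  fixes P :: "'v \<Rightarrow> 'v"
  assumes P_linear: "linear_on scale scale V V P"
    and averaging_left: "\<And>x y. x \<in> V \<Longrightarrow> y \<in> V \<Longrightarrow> P x \<odot> P y = P (P x \<odot> y)"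
    and averaging_right: "\<And>x y. x \<in> V \<Longrightarrow> y \<in> V \<Longrightarrow> P x \<odot> P y = P (x \<odot> P y)"

text \<open>Linear maps \<open>A \<rightarrow> End(V)\<close> are curried bilinear maps \<open>A \<times> V \<rightarrow> V\<close>.\<close>

locale pre_lie_representation = pre_lie_algebra sA A mul + V: fd_space sV V
  for sA :: "'k::field_char_0 \<Rightarrow> 'a::ab_group_add \<Rightarrow> 'a" and A and mul  (infixl "\<odot>" 70)
    and sV :: "'k \<Rightarrow> 'v::ab_group_add \<Rightarrow> 'v" and V +
  fixes \<rho> \<phi> :: "'a \<Rightarrow> 'v \<Rightarrow> 'v"
  assumes rho_linear: "bilinear_on sA sV sV A V V \<rho>"
    and phi_linear: "bilinear_on sA sV sV A V V \<phi>"
    and rho_comm: "\<And>x y v. x \<in> A \<Longrightarrow> y \<in> A \<Longrightarrow> v \<in> V \<Longrightarrow>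
      \<rho> (x \<odot> y - y \<odot> x) v = \<rho> x (\<rho> y v) - \<rho> y (\<rho> x v)"
    and phi_mul: "\<And>x y v. x \<in> A \<Longrightarrow> y \<in> A \<Longrightarrow> v \<in> V \<Longrightarrow>
      \<phi> (x \<odot> y) v = \<rho> x (\<phi> y v) - \<phi> y (\<rho> x v) + \<phi> y (\<phi> x v)"

locale averaging_representation =
  averaging_pre_lie_algebra sA A mul P + pre_lie_representation sA A mul sV V \<rho> \<phi>
  for sA :: "'k::field_char_0 \<Rightarrow> 'a::ab_group_add \<Rightarrow> 'a" and A and mul  (infixl "\<odot>" 70) and P
    and sV :: "'k \<Rightarrow> 'v::ab_group_add \<Rightarrow> 'v" and V and \<rho> \<phi> +
  fixes \<alpha> :: "'v \<Rightarrow> 'v"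
  assumes alpha_linear: "linear_on sV sV V V \<alpha>"
    and rho_averaging_left: "\<And>x v. x \<in> A \<Longrightarrow> v \<in> V \<Longrightarrow> \<rho> (P x) (\<alpha> v) = \<alpha> (\<rho> (P x) v)"
    and rho_averaging_right: "\<And>x v. x \<in> A \<Longrightarrow> v \<in> V \<Longrightarrow> \<rho> (P x) (\<alpha> v) = \<alpha> (\<rho> x (\<alpha> v))"
    and phi_averaging_left: "\<And>x v. x \<in> A \<Longrightarrow> v \<in> V \<Longrightarrow> \<phi> (P x) (\<alpha> v) = \<alpha> (\<phi> (P x) v)"
    and phi_averaging_right: "\<And>x v. x \<in> A \<Longrightarrow> v \<in> V \<Longrightarrow> \<phi> (P x) (\<alpha> v) = \<alpha> (\<phi> x (\<alpha> v))"

locale averaging_matched_pair =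
  repA: averaging_representation sA A mulA PA sB B \<rho>A \<phi>A PB +
  repB: averaging_representation sB B mulB PB sA A \<rho>B \<phi>B PA
  for sA :: "'k::field_char_0 \<Rightarrow> 'a::ab_group_add \<Rightarrow> 'a" and A and mulA  (infixl "\<odot>\<^sub>A" 70) and PA
    and sB :: "'k \<Rightarrow> 'b::ab_group_add \<Rightarrow> 'b" and B and mulB  (infixl "\<odot>\<^sub>B" 70) and PB
    and \<rho>A \<phi>A \<rho>B \<phi>B +
  assumes match1: "\<And>x a b. x \<in> A \<Longrightarrow> a \<in> B \<Longrightarrow> b \<in> B \<Longrightarrow>
      \<rho>A x (a \<odot>\<^sub>B b) = - \<rho>A (\<rho>B a x - \<phi>B a x) b + (\<rho>A x a - \<phi>A x a) \<odot>\<^sub>B b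
        + \<phi>A (\<phi>B b x) a + a \<odot>\<^sub>B (\<rho>A x b)"
    and match2: "\<And>x a b. x \<in> A \<Longrightarrow> a \<in> B \<Longrightarrow> b \<in> B \<Longrightarrow>
      \<phi>A x (a \<odot>\<^sub>B b - b \<odot>\<^sub>B a) = \<phi>A (\<rho>B b x) a - \<phi>A (\<rho>B a x) b
        + a \<odot>\<^sub>B (\<phi>A x b) - b \<odot>\<^sub>B (\<phi>A x a)"
    and match3: "\<And>x y a. x \<in> A \<Longrightarrow> y \<in> A \<Longrightarrow> a \<in> B \<Longrightarrow>
      \<rho>B a (x \<odot>\<^sub>A y) = - \<rho>B (\<rho>A x a - \<phi>A x a) y + (\<rho>B a x - \<phi>B a x) \<odot>\<^sub>A y
        + \<phi>B (\<phi>A y a) x + x \<odot>\<^sub>A (\<rho>B a y)"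
    and match4: "\<And>x y a. x \<in> A \<Longrightarrow> y \<in> A \<Longrightarrow> a \<in> B \<Longrightarrow>
      \<phi>B a (x \<odot>\<^sub>A y - y \<odot>\<^sub>A x) = \<phi>B (\<rho>A y a) x - \<phi>B (\<rho>A x a) y
        + x \<odot>\<^sub>A (\<phi>B a y) - y \<odot>\<^sub>A (\<phi>B a x)"


section \<open>Coalgebras and bialgebras\<close>

locale pre_lie_coalgebra = fd_space scale UNIV
  for scale :: "'k::field_char_0 \<Rightarrow> 'a::ab_group_add \<Rightarrow> 'a" +
  fixes \<Delta> :: "'a \<Rightarrow> ('a, 'k) tensor2"
  assumes coproduct_linear: "linear_on scale tensor2_scale UNIV (tensor2 scale) \<Delta>"
    and co_pre_lie: "\<And>x.
      coprod_left scale \<Delta> (\<Delta> x) - coprod_right scale \<Delta> (\<Delta> x) =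
      flip12 (coprod_left scale \<Delta> (\<Delta> x) - coprod_right scale \<Delta> (\<Delta> x))"

locale averaging_pre_lie_coalgebra = pre_lie_coalgebra scale \<Delta>
  for scale :: "'k::field_char_0 \<Rightarrow> 'a::ab_group_add \<Rightarrow> 'a" and \<Delta> +
  fixes S :: "'a \<Rightarrow> 'a"
  assumes S_linear: "linear_on scale scale UNIV UNIV S"
    and co_averaging_left: "\<And>x. tensor_map scale S S (\<Delta> x) = tensor_map scale S id (\<Delta> (S x))"
    and co_averaging_right: "\<And>x. tensor_map scale S S (\<Delta> x) = tensor_map scale id S (\<Delta> (S x))"

locale pre_lie_bialgebra = pre_lie_algebra scale UNIV mul + pre_lie_coalgebra scale \<Delta>
  for scale :: "'k::field_char_0 \<Rightarrow> 'a::ab_group_add \<Rightarrow> 'a" and mul  (infixl "\<odot>" 70) and \<Delta> +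
  assumes compat1: "\<And>x y. \<Delta> (x \<odot> y - y \<odot> x) =
      (tensor_map scale (left_mult mul x) id (\<Delta> y)
        + tensor_map scale id (left_mult mul x - right_mult mul x) (\<Delta> y))
      - (tensor_map scale (left_mult mul y) id (\<Delta> x)
        + tensor_map scale id (left_mult mul y - right_mult mul y) (\<Delta> x))"
    and compat2: "\<And>x y. \<Delta> (x \<odot> y) - flip (\<Delta> (x \<odot> y)) =
      (let t = tensor_map scale id (right_mult mul y) (\<Delta> x)
          + (tensor_map scale (left_mult mul x) id (\<Delta> y)
            + tensor_map scale id (left_mult mul x) (\<Delta> y))
       in t - flip t)"

locale averaging_pre_lie_bialgebra =
  averaging_pre_lie_algebra scale UNIV mul P + averaging_pre_lie_coalgebra scale \<Delta> S +
  pre_lie_bialgebra scale mul \<Delta>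
  for scale :: "'k::field_char_0 \<Rightarrow> 'a::ab_group_add \<Rightarrow> 'a" and mul  (infixl "\<odot>" 70)
    and \<Delta> and P and S +
  assumes PS_left: "\<And>x y. P x \<odot> S y = S (P x \<odot> y)"
    and PS_right: "\<And>x y. P x \<odot> S y = S (x \<odot> S y)"
    and SP_left: "\<And>x y. S x \<odot> P y = S (x \<odot> P y)"
    and SP_right: "\<And>x y. S x \<odot> P y = S (S x \<odot> y)"
    and co_PS_left: "\<And>x. tensor_map scale P S (\<Delta> x) = tensor_map scale id S (\<Delta> (P x))"
    and co_PS_right: "\<And>x. tensor_map scale P S (\<Delta> x) = tensor_map scale P id (\<Delta> (P x))"
    and co_SP_left: "\<And>x. tensor_map scale S P (\<Delta> x) = tensor_map scale S id (\<Delta> (P x))"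
    and co_SP_right: "\<And>x. tensor_map scale S P (\<Delta> x) = tensor_map scale id P (\<Delta> (P x))"


section \<open>Quadratic averaging pre-Lie algebras and Manin triples\<close>

locale quadratic_averaging_pre_lie_algebra = averaging_pre_lie_algebra scale V mul P
  for scale :: "'k::field_char_0 \<Rightarrow> 'v::ab_group_add \<Rightarrow> 'v" and V and mul  (infixl "\<odot>" 70) and P +
  fixes \<omega> :: "'v \<Rightarrow> 'v \<Rightarrow> 'k"
  assumes omega_bilinear: "bilinear_on scale scale (*) V V UNIV \<omega>"
    and omega_skew: "\<And>x y. x \<in> V \<Longrightarrow> y \<in> V \<Longrightarrow> \<omega> x y = - \<omega> y x"
    and omega_nondegenerate: "\<And>x. x \<in> V \<Longrightarrow> (\<And>y. y \<in> V \<Longrightarrow> \<omega> x y = 0) \<Longrightarrow> x = 0"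
    and omega_invariant: "\<And>x y z. x \<in> V \<Longrightarrow> y \<in> V \<Longrightarrow> z \<in> V \<Longrightarrow>
      \<omega> (x \<odot> y) z + \<omega> y (x \<odot> z - z \<odot> x) = 0"
    and omega_P: "\<And>x y. x \<in> V \<Longrightarrow> y \<in> V \<Longrightarrow> \<omega> (P x) y = \<omega> x (P y)"

text \<open>
  The inclusions \<open>A \<subseteq> W\<close> and \<open>B \<subseteq> W\<close> are explicit injective linear maps \<open>\<iota>A\<close>, \<open>\<iota>B\<close>, so that
  \<open>A\<close> and \<open>A*\<close> need not be replaced by \<open>A \<times> {0}\<close> and \<open>{0} \<times> A*\<close>.  For subsets of \<open>W\<close> take
  the identity.
\<close>

locale averaging_manin_triple =
  quadratic_averaging_pre_lie_algebra sW W mulW PW \<omega> +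
  A: averaging_pre_lie_algebra sA A mulA PA +
  B: averaging_pre_lie_algebra sB B mulB PB
  for sW :: "'k::field_char_0 \<Rightarrow> 'w::ab_group_add \<Rightarrow> 'w" and W and mulW  (infixl "\<odot>" 70)
    and PW and \<omega>
    and sA :: "'k \<Rightarrow> 'a::ab_group_add \<Rightarrow> 'a" and A and mulA  (infixl "\<odot>\<^sub>A" 70) and PA
    and sB :: "'k \<Rightarrow> 'b::ab_group_add \<Rightarrow> 'b" and B and mulB  (infixl "\<odot>\<^sub>B" 70) and PB +
  fixes \<iota>A :: "'a \<Rightarrow> 'w" and \<iota>B :: "'b \<Rightarrow> 'w"
  assumes even_dim: "even (dim W)"
    and inclA: "linear_on sA sW A W \<iota>A" "inj_on \<iota>A A"
    and inclB: "linear_on sB sW B W \<iota>B" "inj_on \<iota>B B"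
    and subalgA: "\<And>x y. x \<in> A \<Longrightarrow> y \<in> A \<Longrightarrow> \<iota>A x \<odot> \<iota>A y = \<iota>A (x \<odot>\<^sub>A y)"
    and subalgB: "\<And>a b. a \<in> B \<Longrightarrow> b \<in> B \<Longrightarrow> \<iota>B a \<odot> \<iota>B b = \<iota>B (a \<odot>\<^sub>B b)"
    and restrictA: "\<And>x. x \<in> A \<Longrightarrow> PW (\<iota>A x) = \<iota>A (PA x)"
    and restrictB: "\<And>a. a \<in> B \<Longrightarrow> PW (\<iota>B a) = \<iota>B (PB a)"
    and isotropicA: "\<And>x y. x \<in> A \<Longrightarrow> y \<in> A \<Longrightarrow> \<omega> (\<iota>A x) (\<iota>A y) = 0"
    and isotropicB: "\<And>a b. a \<in> B \<Longrightarrow> b \<in> B \<Longrightarrow> \<omega> (\<iota>B a) (\<iota>B b) = 0"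
    and direct_sum: "W = {u + v | u v. u \<in> \<iota>A ` A \<and> v \<in> \<iota>B ` B}" "\<iota>A ` A \<inter> \<iota>B ` B = {0}"


section \<open>The double of \<open>A\<close> and its dual\<close>

definition double_mul ::
  "('k::field \<Rightarrow> 'a::ab_group_add \<Rightarrow> 'a) \<Rightarrow> ('a \<Rightarrow> 'a \<Rightarrow> 'a) \<Rightarrow>
    (('a \<Rightarrow> 'k) \<Rightarrow> ('a \<Rightarrow> 'k) \<Rightarrow> 'a \<Rightarrow> 'k) \<Rightarrow>
    'a \<times> ('a \<Rightarrow> 'k) \<Rightarrow> 'a \<times> ('a \<Rightarrow> 'k) \<Rightarrow> 'a \<times> ('a \<Rightarrow> 'k)"
  where "double_mul scale mul muld = (\<lambda>(x, \<xi>) (y, \<eta>).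
    (mul x y
       + (codual_rep scale (left_mult muld) - codual_rep scale (right_mult muld)) \<xi> y
       - codual_rep scale (right_mult muld) \<eta> x,
     muld \<xi> \<eta>
       + (dual_rep (left_mult mul) - dual_rep (right_mult mul)) x \<eta>
       - dual_rep (right_mult mul) y \<xi>))"

definition double_form :: "'a \<times> ('a \<Rightarrow> 'k::minus) \<Rightarrow> 'a \<times> ('a \<Rightarrow> 'k) \<Rightarrow> 'k"
  where "double_form = (\<lambda>(x, \<xi>) (y, \<eta>). \<xi> y - \<eta> x)"

end

theory Submission
  imports Defs
begin

text \<open>
  Pairing every identity with functionals turns all structure maps into transposes of the two
  products: \<open>\<langle>b, \<rho>*(a) x\<rangle>\<close> becomes a value of a dual product at \<open>x\<close>. In this form the first and
  fourth matched pair conditions are both the first bialgebra condition, the second and third are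
  both the second one, and the representation, coalgebra and averaging conditions hold
  automatically because both algebras are given and \<open>S = P\<close>. A matched pair makes the direct sum
  an averaging pre-Lie algebra for the bicrossed product, and the form \<open>\<omega>\<close> is invariant by
  construction. Conversely, the pre-Lie identity of the double on \<open>(x, a, b)\<close> and \<open>(a, b, x)\<close>,
  projected to \<open>A*\<close>, gives back the two bialgebra conditions.
\<close>

section \<open>Linear and bilinear maps on carriers inside an ambient type\<close>

lemma (in fd_space) carrier_subspace: "subspace V"
  using finite_dim subspace_span by blast

lemma (in fd_space) carrier_closed [simp]:
  "0 \<in> V" "x \<in> V \<Longrightarrow> y \<in> V \<Longrightarrow> x + y \<in> V" "x \<in> V \<Longrightarrow> y \<in> V \<Longrightarrow> x - y \<in> V" "x \<in> V \<Longrightarrow> - x \<in> V"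
  "x \<in> V \<Longrightarrow> scale c x \<in> V"
  using carrier_subspace by (auto intro: subspace_0 subspace_add subspace_diff subspace_neg subspace_scale)

lemma linear_on_closed: "linear_on sV sW V W f \<Longrightarrow> x \<in> V \<Longrightarrow> f x \<in> W"
  by (simp add: linear_on_def)

lemma (in fd_space) linear_on_simps:
  fixes f :: "'v \<Rightarrow> 'w::ab_group_add"
  assumes "linear_on scale sW V W f"
  shows "f 0 = 0"
    and "x \<in> V \<Longrightarrow> y \<in> V \<Longrightarrow> f (x + y) = f x + f y"
    and "x \<in> V \<Longrightarrow> f (- x) = - f x"
    and "x \<in> V \<Longrightarrow> y \<in> V \<Longrightarrow> f (x - y) = f x - f y"
    and "x \<in> V \<Longrightarrow> f (scale c x) = sW c (f x)"
proof -
  show add: "f (x + y) = f x + f y" if "x \<in> V" "y \<in> V" for x y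
    using assms that by (simp add: linear_on_def)
  show zero: "f 0 = 0"
    using add[of 0 0] by simp
  show neg: "f (- x) = - f x" if "x \<in> V" for x
    using add[of x "- x"] that zero by (simp add: eq_neg_iff_add_eq_0 add.commute)
  show "f (x - y) = f x - f y" if "x \<in> V" "y \<in> V"
    using add[of x "- y"] that neg by simp
  show "f (scale c x) = sW c (f x)" if "x \<in> V"
    using assms that by (simp add: linear_on_def)
qed

text \<open>Instantiated below for both products and all four actions of a matched pair; membership
  premises remain because the laws hold on the carriers only.\<close>

lemma bilinear_on_simps:
  fixes f :: "'u::ab_group_add \<Rightarrow> 'v::ab_group_add \<Rightarrow> 'w::ab_group_add"
  assumes U: "fd_space sU U" and V: "fd_space sV V" and f: "bilinear_on sU sV sW U V W f"
  shows "x \<in> U \<Longrightarrow> y \<in> V \<Longrightarrow> f x y \<in> W"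
    and "y \<in> V \<Longrightarrow> f 0 y = 0" and "x \<in> U \<Longrightarrow> f x 0 = 0"
    and "x \<in> U \<Longrightarrow> x' \<in> U \<Longrightarrow> y \<in> V \<Longrightarrow> f (x + x') y = f x y + f x' y"
    and "x \<in> U \<Longrightarrow> y \<in> V \<Longrightarrow> y' \<in> V \<Longrightarrow> f x (y + y') = f x y + f x y'"
    and "x \<in> U \<Longrightarrow> y \<in> V \<Longrightarrow> f (- x) y = - f x y"
    and "x \<in> U \<Longrightarrow> y \<in> V \<Longrightarrow> f x (- y) = - f x y"
    and "x \<in> U \<Longrightarrow> x' \<in> U \<Longrightarrow> y \<in> V \<Longrightarrow> f (x - x') y = f x y - f x' y"
    and "x \<in> U \<Longrightarrow> y \<in> V \<Longrightarrow> y' \<in> V \<Longrightarrow> f x (y - y') = f x y - f x y'"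
    and "x \<in> U \<Longrightarrow> y \<in> V \<Longrightarrow> f (sU c x) y = sW c (f x y)"
    and "x \<in> U \<Longrightarrow> y \<in> V \<Longrightarrow> f x (sV c y) = sW c (f x y)"
proof -
  have l: "linear_on sU sW U W (\<lambda>x. f x y)" if "y \<in> V" for y
    using f that by (simp add: bilinear_on_def)
  have r: "linear_on sV sW V W (f x)" if "x \<in> U" for x
    using f that by (simp add: bilinear_on_def)
  show "x \<in> U \<Longrightarrow> y \<in> V \<Longrightarrow> f x y \<in> W" for x y
    using r by (simp add: linear_on_def)
  show "y \<in> V \<Longrightarrow> f 0 y = 0" "x \<in> U \<Longrightarrow> x' \<in> U \<Longrightarrow> y \<in> V \<Longrightarrow> f (x + x') y = f x y + f x' y"
    "x \<in> U \<Longrightarrow> y \<in> V \<Longrightarrow> f (- x) y = - f x y"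
    "x \<in> U \<Longrightarrow> x' \<in> U \<Longrightarrow> y \<in> V \<Longrightarrow> f (x - x') y = f x y - f x' y"
    "x \<in> U \<Longrightarrow> y \<in> V \<Longrightarrow> f (sU c x) y = sW c (f x y)"
    using fd_space.linear_on_simps[OF U l] by auto
  show "x \<in> U \<Longrightarrow> f x 0 = 0" "x \<in> U \<Longrightarrow> y \<in> V \<Longrightarrow> y' \<in> V \<Longrightarrow> f x (y + y') = f x y + f x y'"
    "x \<in> U \<Longrightarrow> y \<in> V \<Longrightarrow> f x (- y) = - f x y"
    "x \<in> U \<Longrightarrow> y \<in> V \<Longrightarrow> y' \<in> V \<Longrightarrow> f x (y - y') = f x y - f x y'"
    "x \<in> U \<Longrightarrow> y \<in> V \<Longrightarrow> f x (sV c y) = sW c (f x y)"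
    using fd_space.linear_on_simps[OF V r] by auto
qed

section \<open>Direct sums of finite-dimensional spaces\<close>

lemma vector_space_prod_scale:
  assumes "vector_space s" "vector_space t"
  shows "vector_space (prod_scale s t)"
proof -
  interpret s: vector_space s by fact
  interpret t: vector_space t by fact
  show ?thesis
    by unfold_locales (auto simp: prod_scale_def s.scale_right_distrib s.scale_left_distrib
        t.scale_right_distrib t.scale_left_distrib)
qed

text \<open>Serves twice: for the finite dimension of a direct sum, and for the span of a basis of
  the double assembled from a basis of \<open>A\<close> and its dual basis.\<close>

lemma span_prod_scale:
  assumes s: "vector_space s" and t: "vector_space t"
  shows "module.span (prod_scale s t) ((\<lambda>x. (x, 0)) ` B \<union> (\<lambda>y. (0, y)) ` C)
    = module.span s B \<times> module.span t C" (is "?L = ?R")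
proof
  interpret s: vector_space s by fact
  interpret t: vector_space t by fact
  interpret p: vector_space "prod_scale s t" using s t by (rule vector_space_prod_scale)
  show "?L \<subseteq> ?R"
  proof (rule p.span_minimal)
    show "p.subspace ?R"
      by (rule p.subspaceI)
        (auto simp: prod_scale_def zero_prod_def s.span_zero t.span_zero s.span_add t.span_add
          s.span_scale t.span_scale)
  qed (auto intro: s.span_base t.span_base s.span_zero t.span_zero)
  have "(x, 0) \<in> ?L" if "x \<in> s.span B" for x
    using that
  proof (induction rule: s.span_induct_alt)
    case base
    then show ?case using p.span_zero by (simp add: zero_prod_def)
  next
    case (step c x y)
    then have "prod_scale s t c (x, 0) + (y, 0) \<in> ?L"
      by (intro p.span_add[OF p.span_scale[OF p.span_base]]) auto
    then show ?case by (simp add: prod_scale_def[of s t c "(x, 0)"])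
  qed
  moreover have "(0, y) \<in> ?L" if "y \<in> t.span C" for y
    using that
  proof (induction rule: t.span_induct_alt)
    case base
    then show ?case using p.span_zero by (simp add: zero_prod_def)
  next
    case (step c x y)
    then have "prod_scale s t c (0, x) + (0, y) \<in> ?L"
      by (intro p.span_add[OF p.span_scale[OF p.span_base]]) auto
    then show ?case by (simp add: prod_scale_def[of s t c "(0, x)"])
  qed
  ultimately have "(x, 0) + (0, y) \<in> ?L" if "x \<in> s.span B" "y \<in> t.span C" for x y
    using that p.span_add by blast
  then show "?R \<subseteq> ?L" by auto
qed

lemma fd_space_prod:
  assumes "fd_space s V" "fd_space t W"
  shows "fd_space (prod_scale s t) (V \<times> W)"
proof -
  interpret s: fd_space s V by fact
  interpret t: fd_space t W by fact
  interpret p: vector_space "prod_scale s t"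
    by (intro vector_space_prod_scale s.vector_space_axioms t.vector_space_axioms)
  obtain B C where "finite B" "s.span B = V" "finite C" "t.span C = W"
    using s.finite_dim t.finite_dim by blast
  then have "finite ((\<lambda>x. (x, 0)) ` B \<union> (\<lambda>y. (0, y)) ` C)"
    "p.span ((\<lambda>x. (x, 0)) ` B \<union> (\<lambda>y. (0, y)) ` C) = V \<times> W"
    using span_prod_scale[OF s.vector_space_axioms t.vector_space_axioms, of B C] by auto
  then show ?thesis by unfold_locales blast
qed

section \<open>The bicrossed product\<close>

context averaging_matched_pair
begin

text \<open>The actions \<open>\<phi>\<close> multiply from the right, so their acting element comes
  from the second factor.\<close>

definition bicrossed :: "'a \<times> 'b \<Rightarrow> 'a \<times> 'b \<Rightarrow> 'a \<times> 'b"
  where "bicrossed = (\<lambda>(x, a) (y, b).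
    (x \<odot>\<^sub>A y + \<rho>B a y + \<phi>B b x, a \<odot>\<^sub>B b + \<rho>A x b + \<phi>A y a))"

lemmas A_space = repA.fd_space_axioms and B_space = repA.V.fd_space_axioms

lemmas product_simps =
  bilinear_on_simps[OF A_space A_space repA.mul_bilinear]
  bilinear_on_simps[OF B_space B_space repB.mul_bilinear]
  bilinear_on_simps[OF A_space B_space repA.rho_linear]
  bilinear_on_simps[OF A_space B_space repA.phi_linear]
  bilinear_on_simps[OF B_space A_space repB.rho_linear]
  bilinear_on_simps[OF B_space A_space repB.phi_linear]

lemmas P_simps =
  repA.linear_on_simps[OF repA.P_linear] repA.V.linear_on_simps[OF repB.P_linear]
  linear_on_closed[OF repA.P_linear] linear_on_closed[OF repB.P_linear]

lemma bicrossed_bilinear: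
  "bilinear_on (prod_scale sA sB) (prod_scale sA sB) (prod_scale sA sB) (A \<times> B) (A \<times> B) (A \<times> B)
    bicrossed"
  unfolding bilinear_on_def linear_on_def bicrossed_def
  by (auto simp: product_simps prod_scale_def algebra_simps
      repA.scale_right_distrib repA.V.scale_right_distrib)

text \<open>Difference of the associators of \<open>u, v, w\<close> and \<open>v, u, w\<close>. The
  pre-Lie identity becomes the vanishing of a map that is additive in each argument and skew in the
  first two.\<close>

definition defect :: "'a \<times> 'b \<Rightarrow> 'a \<times> 'b \<Rightarrow> 'a \<times> 'b \<Rightarrow> 'a \<times> 'b"
  where "defect u v w =
    bicrossed (bicrossed u v) w - bicrossed u (bicrossed v w)
    - (bicrossed (bicrossed v u) w - bicrossed v (bicrossed u w))"

lemma defect_swap: "defect u v w = - defect v u w"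
  by (simp add: defect_def)

lemma defect_add:
  assumes "u \<in> A \<times> B" "v \<in> A \<times> B" "w \<in> A \<times> B"
  shows "u' \<in> A \<times> B \<Longrightarrow> defect (u + u') v w = defect u v w + defect u' v w"
    and "v' \<in> A \<times> B \<Longrightarrow> defect u (v + v') w = defect u v w + defect u v' w"
    and "w' \<in> A \<times> B \<Longrightarrow> defect u v (w + w') = defect u v w + defect u v w'"
proof -
  note space = fd_space_prod[OF A_space B_space]
  note simps = bilinear_on_simps[OF space space bicrossed_bilinear] fd_space.carrier_closed[OF space]
  show "u' \<in> A \<times> B \<Longrightarrow> defect (u + u') v w = defect u v w + defect u' v w"
    "v' \<in> A \<times> B \<Longrightarrow> defect u (v + v') w = defect u v w + defect u v' w"
    "w' \<in> A \<times> B \<Longrightarrow> defect u v (w + w') = defect u v w + defect u v w'"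
    using assms by (simp_all add: defect_def simps)
qed

text \<open>Of the two components of each mixed triple, one is a representation axiom and the other
  one of the four matching conditions. Unmixed triples give the pre-Lie identities of the
  summands.\<close>

lemma defect_pure:
  assumes "x \<in> A" "y \<in> A" "z \<in> A" "a \<in> B" "b \<in> B" "c \<in> B"
  shows "defect (x, 0) (y, 0) (z, 0) = 0"
    and "defect (x, 0) (y, 0) (0, c) = 0"
    and "defect (x, 0) (0, b) (z, 0) = 0"
    and "defect (x, 0) (0, b) (0, c) = 0"
    and "defect (0, a) (0, b) (z, 0) = 0"
    and "defect (0, a) (0, b) (0, c) = 0"
proof -
  note simps = defect_def bicrossed_def zero_prod_def product_simps
  show "defect (x, 0) (y, 0) (z, 0) = 0"
    using assms repA.pre_lie[of x y z] by (simp add: simps algebra_simps)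
  show "defect (0, a) (0, b) (0, c) = 0"
    using assms repB.pre_lie[of a b c] by (simp add: simps algebra_simps)
  show "defect (x, 0) (y, 0) (0, c) = 0"
    using assms repA.rho_comm[of x y c] match4[of x y c] by (simp add: simps algebra_simps)
  show "defect (0, a) (0, b) (z, 0) = 0"
    using assms repB.rho_comm[of a b z] match2[of z a b] by (simp add: simps algebra_simps)
  show "defect (x, 0) (0, b) (z, 0) = 0"
    using assms repA.phi_mul[of x z b] match3[of x z b] by (simp add: simps algebra_simps)
  show "defect (x, 0) (0, b) (0, c) = 0"
    using assms repB.phi_mul[of b c x] match1[of x b c] by (simp add: simps algebra_simps)
qed

lemma bicrossed_pre_lie:
  assumes "u \<in> A \<times> B" "v \<in> A \<times> B" "w \<in> A \<times> B"
  shows "bicrossed (bicrossed u v) w - bicrossed u (bicrossed v w)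
    = bicrossed (bicrossed v u) w - bicrossed v (bicrossed u w)"
proof -
  obtain x y z a b c where uvw: "u = (x, 0) + (0, a)" "v = (y, 0) + (0, b)" "w = (z, 0) + (0, c)"
    and mem: "x \<in> A" "y \<in> A" "z \<in> A" "a \<in> B" "b \<in> B" "c \<in> B"
    using assms by auto
  \<comment> \<open>The two remaining types of pure triples follow by skewness in the first two
    arguments.\<close>
  have "defect (0, a) (y, 0) w' = 0" if "w' = (z, 0) \<or> w' = (0, c)" for w'
    using that defect_pure[OF mem(2,1,3,5,4,6)] by (auto simp: defect_swap[of "(0, a)" "(y, 0)"])
  \<comment> \<open>With \<open>add_Pair\<close> removed the sums in \<open>uvw\<close> are not
    merged into pairs, and additivity expands the defect into eight pure terms.\<close>
  then have "defect u v w = 0"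
    using mem defect_pure[OF mem] fd_space.carrier_closed(2)[OF fd_space_prod[OF A_space B_space]]
    unfolding uvw by (simp add: defect_add del: add_Pair)
  then show ?thesis by (simp add: defect_def)
qed

text \<open>The averaging laws split into one term for each product and each action. Since
  \<open>\<phi>\<close> acts from the right, the left averaging law of the sum needs the right law
  for \<open>\<phi>\<close>, and vice versa.\<close>

theorem averaging_bicrossed:
  "averaging_pre_lie_algebra (prod_scale sA sB) (A \<times> B) bicrossed (map_prod PA PB)"
proof -
  interpret W: fd_space "prod_scale sA sB" "A \<times> B"
    by (rule fd_space_prod[OF A_space B_space])
  show ?thesis
  proof unfold_locales
    show "linear_on (prod_scale sA sB) (prod_scale sA sB) (A \<times> B) (A \<times> B) (map_prod PA PB)"
      by (auto simp: linear_on_def prod_scale_def P_simps)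
  next
    fix u v assume uv: "u \<in> A \<times> B" "v \<in> A \<times> B"
    show "bicrossed (map_prod PA PB u) (map_prod PA PB v)
        = map_prod PA PB (bicrossed (map_prod PA PB u) v)"
      using uv by (auto simp: bicrossed_def product_simps P_simps
          repA.averaging_left repA.rho_averaging_left repA.phi_averaging_right
          repB.averaging_left repB.rho_averaging_left repB.phi_averaging_right)
    show "bicrossed (map_prod PA PB u) (map_prod PA PB v)
        = map_prod PA PB (bicrossed u (map_prod PA PB v))"
      using uv by (auto simp: bicrossed_def product_simps P_simps
          repA.averaging_right repA.rho_averaging_right repA.phi_averaging_left
          repB.averaging_right repB.rho_averaging_right repB.phi_averaging_left)
  qed (fact bicrossed_bilinear bicrossed_pre_lie)+
qed

end

section \<open>The dual space\<close>

text \<open>A functional that vanishes on a set but not at \<open>v\<close> keeps \<open>v\<close>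
  out of its span; independence is proved this way below.\<close>

lemma (in vector_space) functional_vanishes_on_span:
  assumes "\<And>x y. f (x + y) = f x + f y" "\<And>c x. f (scale c x) = c * (f x :: 'a)"
    and "\<And>x. x \<in> S \<Longrightarrow> f x = 0" and "v \<in> span S"
  shows "f v = 0"
  using assms(4)
proof (induction rule: span_induct_alt)
  case base
  then show ?case using assms(2)[of 0 0] by simp
qed (simp add: assms)

context finite_dimensional_vector_space
begin

text \<open>The coordinate functionals form the dual basis: by \<open>dual_expansion\<close>, a
  functional has its values on the basis as coefficients.\<close>

lemma span_dual_basis:
  "module.span dual_scale ((\<lambda>b x. representation Basis x b) ` Basis) = dual scale"
proof
  interpret f: vector_space "dual_scale :: 'a \<Rightarrow> ('b \<Rightarrow> 'a) \<Rightarrow> 'b \<Rightarrow> 'a"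
    by (intro vector_space_fun_scale vector_space_mult)
  show "f.span ((\<lambda>b x. representation Basis x b) ` Basis) \<subseteq> dual scale"
  proof (rule f.span_minimal)
    show "f.subspace (dual scale)"
      by (rule f.subspaceI) (auto simp: dual_iff[OF vector_space_axioms] fun_scale_def algebra_simps)
  qed (auto simp: coord_in_dual)
  show "dual scale \<subseteq> f.span ((\<lambda>b x. representation Basis x b) ` Basis)"
  proof
    fix \<xi> assume "\<xi> \<in> dual scale"
    then show "\<xi> \<in> f.span ((\<lambda>b x. representation Basis x b) ` Basis)"
      using dual_expansion[of \<xi>]
        f.span_sum[OF f.span_scale[OF f.span_base], of Basis "\<lambda>b x. representation Basis x b" _ \<xi>]
      by simp
  qed
qed

text \<open>A basis of \<open>A\<close> together with its dual basis is a basis of the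
  double.\<close>

lemma even_dim_double:
  "even (vector_space.dim (prod_scale scale dual_scale) (UNIV \<times> dual scale))"
proof -
  have vs: "vector_space (dual_scale :: 'a \<Rightarrow> ('b \<Rightarrow> 'a) \<Rightarrow> 'b \<Rightarrow> 'a)"
    by (intro vector_space_fun_scale vector_space_mult)
  interpret p: vector_space "prod_scale scale (dual_scale :: 'a \<Rightarrow> ('b \<Rightarrow> 'a) \<Rightarrow> 'b \<Rightarrow> 'a)"
    by (intro vector_space_prod_scale vector_space_axioms vs)
  let ?r = "\<lambda>b x. representation Basis x b"
  let ?S1 = "(\<lambda>x. (x, 0 :: 'b \<Rightarrow> 'a)) ` Basis"
  let ?S2 = "(\<lambda>\<xi>. (0 :: 'b, \<xi>)) ` ?r ` Basis"
  let ?S = "?S1 \<union> ?S2"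
  have r: "?r b c = (if c = b then 1 else 0)" if "c \<in> Basis" for b c
    using representation_basis[OF independent_Basis that] by auto
  have r0: "?r b 0 = 0" for b by (simp add: representation_zero)
  have b0: "b \<noteq> 0" if "b \<in> Basis" for b
    using that independent_Basis dependent_zero by blast
  have inj: "inj_on ?r Basis"
    by (rule inj_onI) (metis r one_neq_zero)
  have span: "p.span ?S = UNIV \<times> dual scale"
    by (simp only: span_prod_scale[OF vector_space_axioms vs] span_Basis span_dual_basis)
  have indep: "p.independent ?S"
    unfolding p.dependent_def
  proof safe
    fix b assume b: "b \<in> Basis" and sp: "(b, 0) \<in> p.span (?S - {(b, 0)})"
    \<comment> \<open>The \<open>b\<close>-coordinate of the first component is 1 at
      \<open>(b, 0)\<close> and 0 at all other members of \<open>?S\<close>.\<close>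
    have "?r b (fst (b, 0 :: 'b \<Rightarrow> 'a)) = 0"
      by (rule p.functional_vanishes_on_span[OF _ _ _ sp, where f = "\<lambda>w. ?r b (fst w)"])
        (use r r0 in \<open>auto simp: prod_scale_def representation_add representation_scale
          independent_Basis span_Basis split: if_splits\<close>)
    then show False using r[OF b, of b] by simp
  next
    fix b assume b: "b \<in> Basis" and sp: "(0, ?r b) \<in> p.span (?S - {(0, ?r b)})"
    \<comment> \<open>Evaluating the second component at \<open>b\<close> gives 1 at
      \<open>(0, ?r b)\<close> and 0 at all other members of \<open>?S\<close>.\<close>
    have "snd (0 :: 'b, ?r b) b = 0"
      by (rule p.functional_vanishes_on_span[OF _ _ _ sp, where f = "\<lambda>w. snd w b"])
        (use r in \<open>auto simp: prod_scale_def fun_scale_def b split: if_splits\<close>)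
    then show False using r[OF b, of b] by simp
  qed
  have "card ?S1 = card Basis" "card ?S2 = card Basis"
    by (simp_all add: card_image inj inj_on_def[of "\<lambda>x. (x, 0)"] inj_on_def[of "\<lambda>x. (0, x)"])
  \<comment> \<open>A common element would have a basis vector equal to 0 as its first
    component.\<close>
  moreover have "?S1 \<inter> ?S2 = {}" using b0 by auto
  ultimately have "card ?S = 2 * card Basis"
    by (simp add: card_Un_disjoint finite_Basis)
  moreover have "p.dim (UNIV \<times> dual scale) = card ?S"
    using p.dim_span_eq_card_independent[OF indep] by (simp only: span)
  ultimately show ?thesis by simp
qed

text \<open>Coordinates are functionals, so such \<open>x\<close> and \<open>y\<close> have equal
  coordinates.\<close>

lemma dual_separates:
  assumes "\<And>\<xi>. \<xi> \<in> dual scale \<Longrightarrow> \<xi> x = \<xi> y"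
  shows "x = y"
proof -
  have "representation Basis x b = representation Basis y b" for b
    using assms[OF coord_in_dual[of b]] .
  then have "(\<Sum>b\<in>Basis. scale (representation Basis x b) b)
      = (\<Sum>b\<in>Basis. scale (representation Basis y b) b)"
    by (simp only:)
  then show ?thesis by (simp only: basis_expansion)
qed

text \<open>Reflexivity of a finite-dimensional space; it makes the definite description in
  \<open>codual_rep\<close> well defined.\<close>

lemma bidual_representable:
  assumes "linear_on dual_scale (*) (dual scale) UNIV f"
  shows "\<exists>!y. \<forall>\<xi>\<in>dual scale. \<xi> y = f \<xi>"
proof (rule ex_ex1I)
  let ?r = "\<lambda>b x. representation Basis x b"
  \<comment> \<open>The representing vector has the values of \<open>f\<close> on the dual basis as
    coordinates.\<close>
  have "\<xi> (\<Sum>b\<in>Basis. scale (f (?r b)) b) = f \<xi>" if "\<xi> \<in> dual scale" for \<xi>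
  proof -
    have "f \<xi> = f (\<Sum>b\<in>Basis. dual_scale (\<xi> b) (?r b))"
      using dual_expansion[OF that] by simp
    also have "\<dots> = (\<Sum>b\<in>Basis. \<xi> b * f (?r b))"
      using assms finite_Basis coord_in_dual by (rule linear_on_dual_sum)
    finally show ?thesis by (simp add: dual_sum[OF that] mult.commute)
  qed
  then show "\<exists>y. \<forall>\<xi>\<in>dual scale. \<xi> y = f \<xi>" by blast
qed (auto intro: dual_separates)

end

text \<open>A maximal independent subset of the finite spanning set is a basis; this gives access to
  the results stated relative to a basis.\<close>

lemma fd_space_UNIV_basis:
  assumes "fd_space scale UNIV"
  obtains B where "finite_dimensional_vector_space scale B"
proof -
  interpret fd_space scale UNIV by fact
  obtain C where C: "finite C" "span C = UNIV" using finite_dim by blast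
  obtain B where B: "B \<subseteq> C" "independent B" "C \<subseteq> span B"
    using maximal_independent_subset by blast
  have "span B = UNIV" using B(3) C(2) span_minimal[of C "span B"] by auto
  moreover have "finite B" using B(1) C(1) finite_subset by blast
  ultimately have "finite_dimensional_vector_space scale B"
    using B(2) by unfold_locales
  then show thesis ..
qed


section \<open>Pairs of averaging pre-Lie structures on \<open>A\<close> and \<open>A*\<close>\<close>

locale dual_averaging_pair =
  A: averaging_pre_lie_algebra scale UNIV mul P +
  D: averaging_pre_lie_algebra dual_scale "dual scale" muld "transpose_map P"
  for scale :: "'k::field_char_0 \<Rightarrow> 'a::ab_group_add \<Rightarrow> 'a"
    and mul  (infixl "\<odot>" 70) and muld  (infixl "\<bullet>" 70) and P
begin

abbreviation (input) "D \<equiv> dual scale"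
abbreviation (input) Pt :: "('a \<Rightarrow> 'k) \<Rightarrow> 'a \<Rightarrow> 'k"
  where "Pt \<equiv> transpose_map P"
abbreviation (input) \<rho>A :: "'a \<Rightarrow> ('a \<Rightarrow> 'k) \<Rightarrow> 'a \<Rightarrow> 'k"
  where "\<rho>A \<equiv> dual_rep (left_mult mul) - dual_rep (right_mult mul)"
abbreviation (input) \<phi>A :: "'a \<Rightarrow> ('a \<Rightarrow> 'k) \<Rightarrow> 'a \<Rightarrow> 'k"
  where "\<phi>A \<equiv> - dual_rep (right_mult mul)"
abbreviation (input) "\<rho>D \<equiv> codual_rep scale (left_mult muld) - codual_rep scale (right_mult muld)"
abbreviation (input) "\<phi>D \<equiv> - codual_rep scale (right_mult muld)"

text \<open>\<open>lact\<close> and \<open>ract\<close> are the transposes of left and right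
  multiplication, without the sign built into \<open>dual_rep\<close>.\<close>

definition lact :: "'a \<Rightarrow> ('a \<Rightarrow> 'k) \<Rightarrow> 'a \<Rightarrow> 'k"
  where "lact x a = (\<lambda>v. a (x \<odot> v))"

definition ract :: "'a \<Rightarrow> ('a \<Rightarrow> 'k) \<Rightarrow> 'a \<Rightarrow> 'k"
  where "ract x a = (\<lambda>v. a (v \<odot> x))"

lemmas mul_simps [simp] =
  bilinear_on_simps(2-)[OF A.fd_space_axioms A.fd_space_axioms A.mul_bilinear, simplified]
lemmas muld_simps [simp] =
  bilinear_on_simps[OF D.fd_space_axioms D.fd_space_axioms D.mul_bilinear]
lemmas P_simps [simp] = A.linear_on_simps[OF A.P_linear, simplified]

lemmas dual_mem_iff = dual_iff[OF A.vector_space_axioms]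

lemma dual_linear_on: "a \<in> D \<Longrightarrow> linear_on scale (*) UNIV UNIV a"
  by (simp add: dual_mem_iff linear_on_def)

lemmas dual_simps [simp] = A.linear_on_simps[OF dual_linear_on, simplified]

lemma lact_in_dual [simp]: "a \<in> D \<Longrightarrow> lact x a \<in> D"
  by (simp add: lact_def dual_mem_iff[of "\<lambda>v. a (x \<odot> v)"])

lemma ract_in_dual [simp]: "a \<in> D \<Longrightarrow> ract x a \<in> D"
  by (simp add: ract_def dual_mem_iff[of "\<lambda>v. a (v \<odot> x)"])

lemma Pt_in_dual [simp]: "a \<in> D \<Longrightarrow> Pt a \<in> D"
  using D.P_linear by (rule linear_on_closed)

lemma Pt_apply: "Pt a x = a (P x)"
  by (simp add: transpose_map_def)

lemma lact_apply [simp]: "lact x a y = a (x \<odot> y)"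
  by (simp add: lact_def)

lemma ract_apply [simp]: "ract x a y = a (y \<odot> x)"
  by (simp add: ract_def)

lemma dual_left: "dual_rep (left_mult mul) x a = - lact x a"
  by (simp add: fun_eq_iff dual_rep_def left_mult_def)

lemma dual_right: "dual_rep (right_mult mul) x a = - ract x a"
  by (simp add: fun_eq_iff dual_rep_def right_mult_def)

lemmas dual_rep_simps = dual_left dual_right

text \<open>Resolves the definite description once and for all; later arguments use only pairings
  with functionals.\<close>

lemma codual_rep_pairing:
  assumes "linear_on dual_scale dual_scale D D (\<rho> a)" and "b \<in> D"
  shows "b (codual_rep scale \<rho> a x) = - \<rho> a b x"
proof -
  obtain B where "finite_dimensional_vector_space scale B"
    using fd_space_UNIV_basis[OF A.fd_space_axioms] .
  then interpret fin: finite_dimensional_vector_space scale B .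
  have "linear_on dual_scale (*) D UNIV (\<lambda>b. - \<rho> a b x)"
    using assms(1) by (simp add: linear_on_def fun_scale_def)
  from theI'[OF fin.bidual_representable[OF this]] assms(2) show ?thesis
    unfolding codual_rep_def by blast
qed

abbreviation (input) "cl \<equiv> codual_rep scale (left_mult muld)"
abbreviation (input) "cr \<equiv> codual_rep scale (right_mult muld)"

lemma codual_left_pairing: "a \<in> D \<Longrightarrow> b \<in> D \<Longrightarrow> b (cl a x) = - (a \<bullet> b) x"
  by (subst codual_rep_pairing) (auto simp: left_mult_def linear_on_def)

lemma codual_right_pairing: "a \<in> D \<Longrightarrow> b \<in> D \<Longrightarrow> b (cr a x) = - (b \<bullet> a) x"
  by (subst codual_rep_pairing) (auto simp: right_mult_def linear_on_def)

text \<open>Multiplication by \<open>y\<close> and the operator \<open>P\<close> are moved from the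
  vector to the functional, where they become \<open>lact\<close>, \<open>ract\<close> and
  \<open>Pt\<close>.\<close>

lemma pairing_mul:
  assumes "a \<in> D" "b \<in> D"
  shows "b (y \<odot> cl a x) = - (a \<bullet> lact y b) x"
    and "b (cl a x \<odot> y) = - (a \<bullet> ract y b) x"
    and "b (y \<odot> cr a x) = - (lact y b \<bullet> a) x"
    and "b (cr a x \<odot> y) = - (ract y b \<bullet> a) x"
    and "b (P (cl a x)) = - (a \<bullet> Pt b) x"
    and "b (P (cr a x)) = - (Pt b \<bullet> a) x"
  using codual_left_pairing[OF assms(1), of "lact y b" x]
    codual_left_pairing[OF assms(1), of "ract y b" x]
    codual_right_pairing[OF assms(1), of "lact y b" x]
    codual_right_pairing[OF assms(1), of "ract y b" x]
    codual_left_pairing[OF assms(1), of "Pt b" x]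
    codual_right_pairing[OF assms(1), of "Pt b" x] assms(2)
  by (simp_all add: Pt_apply)

lemmas pairing = codual_left_pairing codual_right_pairing pairing_mul

lemma dual_eqI: "(\<And>a. a \<in> D \<Longrightarrow> a x = a y) \<Longrightarrow> x = y"
proof -
  obtain B where "finite_dimensional_vector_space scale B"
    using fd_space_UNIV_basis[OF A.fd_space_axioms] .
  then interpret fin: finite_dimensional_vector_space scale B .
  show "(\<And>a. a \<in> D \<Longrightarrow> a x = a y) \<Longrightarrow> x = y" by (rule fin.dual_separates)
qed


section \<open>Averaging and compatibility as scalar identities between values of the two
  products\<close>

lemma muld_P:
  assumes "a \<in> D" "b \<in> D"
  shows "(Pt a \<bullet> b) (P x) = (Pt a \<bullet> Pt b) x" "(a \<bullet> Pt b) (P x) = (Pt a \<bullet> Pt b) x"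
  using D.averaging_left[OF assms] D.averaging_right[OF assms] by (auto simp: fun_eq_iff transpose_map_def)

text \<open>The difference of the two sides of the first bialgebra condition, paired with
  \<open>a\<close> \<otimes> \<open>b\<close>; the tensor maps appear as transposes acting on
  \<open>a\<close> and \<open>b\<close>.\<close>

definition cocycle1 :: "'a \<Rightarrow> 'a \<Rightarrow> ('a \<Rightarrow> 'k) \<Rightarrow> ('a \<Rightarrow> 'k) \<Rightarrow> 'k"
  where "cocycle1 x y a b = (a \<bullet> b) (x \<odot> y - y \<odot> x)
    - ((lact x a \<bullet> b) y + (a \<bullet> (lact x b - ract x b)) y
      - ((lact y a \<bullet> b) x + (a \<bullet> (lact y b - ract y b)) x))"

text \<open>The same for the second bialgebra condition; the flip exchanges \<open>a\<close> and
  \<open>b\<close>.\<close>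

definition cocycle2 :: "'a \<Rightarrow> 'a \<Rightarrow> ('a \<Rightarrow> 'k) \<Rightarrow> ('a \<Rightarrow> 'k) \<Rightarrow> 'k"
  where "cocycle2 x y a b = (a \<bullet> b) (x \<odot> y) - (b \<bullet> a) (x \<odot> y)
    - ((a \<bullet> ract y b) x + ((lact x a \<bullet> b) y + (a \<bullet> lact x b) y)
      - ((b \<bullet> ract y a) x + ((lact x b \<bullet> a) y + (b \<bullet> lact x a) y)))"

text \<open>The common form to which the bialgebra, the matched pair and the Manin triple are each
  reduced.\<close>

definition compatible :: bool
  where "compatible \<longleftrightarrow>
    (\<forall>x y. \<forall>a\<in>D. \<forall>b\<in>D. cocycle1 x y a b = 0 \<and> cocycle2 x y a b = 0)"

text \<open>Evaluated at \<open>y\<close>, the two sides of the first matching condition differ by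
  the first cocycle.\<close>

lemma match1_cocycle:
  assumes "a \<in> D" "b \<in> D"
  shows "(- \<rho>A (\<rho>D a x - \<phi>D a x) b + (\<rho>A x a - \<phi>A x a) \<bullet> b + \<phi>A (\<phi>D b x) a + a \<bullet> \<rho>A x b) y
    = \<rho>A x (a \<bullet> b) y + cocycle1 x y a b"
  using assms by (simp add: cocycle1_def dual_rep_simps pairing algebra_simps)

text \<open>Here the point of evaluation \<open>y\<close> becomes the first argument of the cocycle,
  because \<open>\<phi>A x\<close> is the transpose of right multiplication by
  \<open>x\<close>.\<close>

lemma match2_cocycle:
  assumes "a \<in> D" "b \<in> D"
  shows "(\<phi>A (\<rho>D b x) a - \<phi>A (\<rho>D a x) b + a \<bullet> \<phi>A x b - b \<bullet> \<phi>A x a) y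
    = \<phi>A x (a \<bullet> b - b \<bullet> a) y - cocycle2 y x a b"
  using assms by (simp add: cocycle2_def dual_rep_simps pairing algebra_simps)

text \<open>Paired with \<open>b\<close>, the third condition yields the same cocycle as the second,
  so the two are equivalent.\<close>

lemma match3_cocycle:
  assumes "a \<in> D" "b \<in> D"
  shows "b (- \<rho>D (\<rho>A x a - \<phi>A x a) y + (\<rho>D a x - \<phi>D a x) \<odot> y + \<phi>D (\<phi>A y a) x + x \<odot> \<rho>D a y)
    = b (\<rho>D a (x \<odot> y)) + cocycle2 x y a b"
  using assms by (simp add: cocycle2_def dual_rep_simps pairing algebra_simps)

text \<open>The fourth condition likewise repeats the first, with \<open>a\<close> and
  \<open>b\<close> exchanged since \<open>\<phi>D a\<close> is dual to right multiplication by
  \<open>a\<close>.\<close>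

lemma match4_cocycle:
  assumes "a \<in> D" "b \<in> D"
  shows "b (\<phi>D (\<rho>A y a) x - \<phi>D (\<rho>A x a) y + x \<odot> \<phi>D a y - y \<odot> \<phi>D a x)
    = b (\<phi>D a (x \<odot> y - y \<odot> x)) - cocycle1 x y b a"
  using assms by (simp add: cocycle1_def dual_rep_simps pairing algebra_simps)

section \<open>The dual representations of the two algebras on each other\<close>

lemma pre_lie_functional:
  "a \<in> D \<Longrightarrow> a ((x \<odot> y) \<odot> z) - a (x \<odot> (y \<odot> z)) = a ((y \<odot> x) \<odot> z) - a (y \<odot> (x \<odot> z))"
  using arg_cong[OF A.pre_lie[of x y z], of a] by simp

lemma dual_pre_lie_apply:
  assumes "a \<in> D" "b \<in> D" "c \<in> D"
  shows "((a \<bullet> b) \<bullet> c) x - (a \<bullet> (b \<bullet> c)) x = ((b \<bullet> a) \<bullet> c) x - (b \<bullet> (a \<bullet> c)) x"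
  using fun_cong[OF D.pre_lie[OF assms], of x] by simp

text \<open>\<open>\<rho>A\<close> is the coadjoint action of the commutator Lie algebra, and
  \<open>\<phi>A x\<close> is \<open>ract x\<close>.\<close>

lemma coadjoint_representation:
  "averaging_representation scale UNIV mul P dual_scale D \<rho>A \<phi>A Pt"
proof unfold_locales
  show "bilinear_on scale dual_scale dual_scale UNIV D D \<rho>A"
    by (simp add: bilinear_on_def linear_on_def fun_eq_iff dual_rep_simps fun_scale_def algebra_simps)
  show "bilinear_on scale dual_scale dual_scale UNIV D D \<phi>A"
    by (simp add: bilinear_on_def linear_on_def fun_eq_iff dual_rep_simps fun_scale_def algebra_simps)
  show "linear_on dual_scale dual_scale D D Pt" by (rule D.P_linear)
next
  fix x y v assume v: "v \<in> D"
  show "\<rho>A (x \<odot> y - y \<odot> x) v = \<rho>A x (\<rho>A y v) - \<rho>A y (\<rho>A x v)"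
  proof
    fix z
    show "\<rho>A (x \<odot> y - y \<odot> x) v z = (\<rho>A x (\<rho>A y v) - \<rho>A y (\<rho>A x v)) z"
      \<comment> \<open>The three instances combine to the Jacobi identity for the
        commutator.\<close>
      using pre_lie_functional[OF v, of x y z] pre_lie_functional[OF v, of x z y]
        pre_lie_functional[OF v, of y z x] v
      by (simp add: dual_rep_simps) algebra
  qed
  show "\<phi>A (x \<odot> y) v = \<rho>A x (\<phi>A y v) - \<phi>A y (\<rho>A x v) + \<phi>A y (\<phi>A x v)"
  proof
    fix z
    show "\<phi>A (x \<odot> y) v z = (\<rho>A x (\<phi>A y v) - \<phi>A y (\<rho>A x v) + \<phi>A y (\<phi>A x v)) z"
      using pre_lie_functional[OF v, of x z y] v
      by (simp add: dual_rep_simps algebra_simps)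
  qed
  \<comment> \<open>After evaluation at a vector, \<open>Pt\<close> turns into \<open>P\<close>
    inside the functional, and the averaging laws are read from right to left.\<close>
  note simps = fun_eq_iff dual_rep_simps Pt_apply A.averaging_left[symmetric] A.averaging_right[symmetric]
  show "\<rho>A (P x) (Pt v) = Pt (\<rho>A (P x) v)" "\<rho>A (P x) (Pt v) = Pt (\<rho>A x (Pt v))"
    "\<phi>A (P x) (Pt v) = Pt (\<phi>A (P x) v)" "\<phi>A (P x) (Pt v) = Pt (\<phi>A x (Pt v))"
    by (simp_all add: simps)
qed

text \<open>The same argument with the roles of \<open>A\<close> and its dual exchanged: each
  identity in \<open>A\<close> is tested against functionals.\<close>

lemma codual_coadjoint_representation:
  "averaging_representation dual_scale D muld Pt scale UNIV \<rho>D \<phi>D P"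
proof unfold_locales
  have scale_apply: "dual_scale c a x = c * a x" for c x and a :: "'a \<Rightarrow> 'k"
    by (simp add: fun_scale_def)
  note simps = pairing scale_apply algebra_simps
  show "bilinear_on dual_scale scale scale D UNIV UNIV \<rho>D"
    unfolding bilinear_on_def linear_on_def
    by (intro conjI ballI allI UNIV_I dual_eqI) (simp_all add: simps)
  show "bilinear_on dual_scale scale scale D UNIV UNIV \<phi>D"
    unfolding bilinear_on_def linear_on_def
    by (intro conjI ballI allI UNIV_I dual_eqI) (simp_all add: simps)
  show "linear_on scale scale UNIV UNIV P" by (rule A.P_linear)
next
  fix a b x assume ab: "a \<in> D" "b \<in> D"
  show "\<rho>D (a \<bullet> b - b \<bullet> a) x = \<rho>D a (\<rho>D b x) - \<rho>D b (\<rho>D a x)"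
  proof (rule dual_eqI)
    fix c assume c: "c \<in> D"
    show "c (\<rho>D (a \<bullet> b - b \<bullet> a) x) = c (\<rho>D a (\<rho>D b x) - \<rho>D b (\<rho>D a x))"
      using ab c dual_pre_lie_apply[of a b c x] dual_pre_lie_apply[of a c b x]
        dual_pre_lie_apply[of b c a x]
      by (simp add: pairing) algebra
  qed
  show "\<phi>D (a \<bullet> b) x = \<rho>D a (\<phi>D b x) - \<phi>D b (\<rho>D a x) + \<phi>D b (\<phi>D a x)"
  proof (rule dual_eqI)
    fix c assume c: "c \<in> D"
    show "c (\<phi>D (a \<bullet> b) x) = c (\<rho>D a (\<phi>D b x) - \<phi>D b (\<rho>D a x) + \<phi>D b (\<phi>D a x))"
      using ab c dual_pre_lie_apply[of a c b x]
      by (simp add: pairing algebra_simps)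
  qed
next
  fix a x assume "a \<in> D"
  then show "\<rho>D (Pt a) (P x) = P (\<rho>D (Pt a) x)" "\<rho>D (Pt a) (P x) = P (\<rho>D a (P x))"
    "\<phi>D (Pt a) (P x) = P (\<phi>D (Pt a) x)" "\<phi>D (Pt a) (P x) = P (\<phi>D a (P x))"
    by (auto intro!: dual_eqI simp: pairing muld_P)
qed


text \<open>Both representations are already established, so only the four matching conditions have
  to be compared with the cocycles.\<close>

lemma matched_pair_iff:
  "averaging_matched_pair scale UNIV mul P dual_scale D muld Pt \<rho>A \<phi>A \<rho>D \<phi>D \<longleftrightarrow> compatible"
    (is "?M \<longleftrightarrow> _")
proof
  assume ?M
  then interpret M: averaging_matched_pair scale UNIV mul P dual_scale D muld Pt \<rho>A \<phi>A \<rho>D \<phi>D .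
  show compatible
    unfolding compatible_def
  proof (intro allI ballI conjI)
    fix x y a b assume "a \<in> D" "b \<in> D"
    then show "cocycle1 x y a b = 0" "cocycle2 x y a b = 0"
      \<comment> \<open>\<open>match2\<close> is taken at \<open>y\<close> and evaluated at
        \<open>x\<close>, which undoes the exchange of arguments in
        \<open>match2_cocycle\<close>.\<close>
      using match1_cocycle[of a b x y] fun_cong[OF M.match1[of x a b], of y]
        match2_cocycle[of a b y x] fun_cong[OF M.match2[of y a b], of x]
      by simp_all
  qed
next
  assume compatible
  then have c: "cocycle1 x y a b = 0" "cocycle2 x y a b = 0" if "a \<in> D" "b \<in> D" for x y a b
    using that by (simp_all add: compatible_def)
  show ?M
  proof (intro averaging_matched_pair.intro averaging_matched_pair_axioms.intro
      coadjoint_representation codual_coadjoint_representation)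
    fix x a b assume ab: "a \<in> D" "b \<in> D"
    show "\<rho>A x (a \<bullet> b) = - \<rho>A (\<rho>D a x - \<phi>D a x) b + (\<rho>A x a - \<phi>A x a) \<bullet> b
        + \<phi>A (\<phi>D b x) a + a \<bullet> \<rho>A x b"
      by (rule ext) (simp only: match1_cocycle[OF ab] c[OF ab] add_0_right)
    show "\<phi>A x (a \<bullet> b - b \<bullet> a) = \<phi>A (\<rho>D b x) a - \<phi>A (\<rho>D a x) b + a \<bullet> \<phi>A x b - b \<bullet> \<phi>A x a"
      by (rule ext) (simp only: match2_cocycle[OF ab] c[OF ab] diff_zero)
  next
    fix x y a assume a: "a \<in> D"
    show "\<rho>D a (x \<odot> y) = - \<rho>D (\<rho>A x a - \<phi>A x a) y + (\<rho>D a x - \<phi>D a x) \<odot> y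
        + \<phi>D (\<phi>A y a) x + x \<odot> \<rho>D a y"
      by (rule dual_eqI) (simp only: match3_cocycle[OF a] c[OF a] add_0_right)
    show "\<phi>D a (x \<odot> y - y \<odot> x) = \<phi>D (\<rho>A y a) x - \<phi>D (\<rho>A x a) y + x \<odot> \<phi>D a y - y \<odot> \<phi>D a x"
      by (rule dual_eqI) (simp only: match4_cocycle[OF a] c[OF _ a] diff_zero)
  qed
qed

section \<open>The double of \<open>A\<close> and its dual, and Manin triples\<close>

lemma codual_zero [simp]: "cl 0 x = 0" "cr 0 x = 0"
  by (auto intro!: dual_eqI simp: pairing)

lemma codual_zero_right [simp]: "a \<in> D \<Longrightarrow> cl a 0 = 0" "a \<in> D \<Longrightarrow> cr a 0 = 0"
  by (auto intro!: dual_eqI simp: pairing)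

lemma transpose_zero [simp]: "lact x 0 = 0" "ract x 0 = 0"
  by (simp_all add: fun_eq_iff)

abbreviation (input) "double \<equiv> double_mul scale mul muld"

text \<open>This component of the pre-Lie defect is the one that carries the first matching
  condition. It is computed from \<open>double\<close> itself, since a Manin triple does not come
  with a matched pair.\<close>

lemma double_cocycle1:
  assumes "a \<in> D" "b \<in> D"
  shows "snd (double (double (x, 0) (0, a)) (0, b) - double (x, 0) (double (0, a) (0, b))
      - (double (double (0, a) (x, 0)) (0, b) - double (0, a) (double (x, 0) (0, b)))) y
    = cocycle1 x y a b"
  using assms
  by (simp add: double_mul_def dual_rep_simps pairing cocycle1_def algebra_simps)

text \<open>With two arguments from the dual first, the component carries the second matching
  condition instead.\<close>

lemma double_cocycle2:
  assumes "a \<in> D" "b \<in> D"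
  shows "snd (double (double (0, a) (0, b)) (y, 0) - double (0, a) (double (0, b) (y, 0))
      - (double (double (0, b) (0, a)) (y, 0) - double (0, b) (double (0, a) (y, 0)))) x
    = cocycle2 x y a b"
  using assms
  by (simp add: double_mul_def dual_rep_simps pairing cocycle2_def algebra_simps)

abbreviation (input) manin :: bool
  where "manin \<equiv> averaging_manin_triple
    (prod_scale scale dual_scale) (UNIV \<times> D) double (map_prod P Pt) double_form
    scale UNIV mul P dual_scale D muld Pt (\<lambda>x. (x, 0)) (\<lambda>\<xi>. (0, \<xi>))"

lemma compatible_imp_manin:
  assumes compatible
  shows manin
proof -
  interpret M: averaging_matched_pair scale UNIV mul P dual_scale D muld Pt \<rho>A \<phi>A \<rho>D \<phi>D
    using assms by (simp only: matched_pair_iff)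
  \<comment> \<open>The minus signs in \<open>\<phi>A\<close> and \<open>\<phi>D\<close> account for
    the subtractions in \<open>double_mul\<close>.\<close>
  have "M.bicrossed = double"
    by (auto simp: fun_eq_iff M.bicrossed_def double_mul_def)
  then interpret W: averaging_pre_lie_algebra "prod_scale scale dual_scale" "UNIV \<times> D" double
    "map_prod P Pt"
    using M.averaging_bicrossed by simp
  obtain B where "finite_dimensional_vector_space scale B"
    using fd_space_UNIV_basis[OF A.fd_space_axioms] .
  then interpret fin: finite_dimensional_vector_space scale B .
  show manin
  proof unfold_locales
    show "bilinear_on (prod_scale scale dual_scale) (prod_scale scale dual_scale) (*)
      (UNIV \<times> D) (UNIV \<times> D) UNIV double_form"
      by (auto simp: bilinear_on_def linear_on_def double_form_def prod_scale_def fun_scale_def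
          algebra_simps)
    show "even (W.dim (UNIV \<times> D))" by (rule fin.even_dim_double)
    show "UNIV \<times> D = {u + v | u v. u \<in> range (\<lambda>x :: 'a. (x, 0)) \<and> v \<in> (\<lambda>\<xi>. (0, \<xi>)) ` D}"
      (is "_ = ?sum")
    proof
      show "UNIV \<times> D \<subseteq> ?sum"
      proof
        fix w :: "'a \<times> ('a \<Rightarrow> 'k)"
        assume "w \<in> UNIV \<times> D"
        then have "w = (fst w, 0) + (0, snd w)" "snd w \<in> D" by auto
        then show "w \<in> ?sum" by blast
      qed
    qed auto
  next
    fix u :: "'a \<times> ('a \<Rightarrow> 'k)"
    assume u: "u \<in> UNIV \<times> D" and zero: "\<And>v. v \<in> UNIV \<times> D \<Longrightarrow> double_form u v = 0"
    \<comment> \<open>Pairing with \<open>(0, b)\<close> shows that every functional vanishes on the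
      first component; pairing with \<open>(y, 0)\<close> evaluates the second at every
      \<open>y\<close>.\<close>
    have "fst u = 0"
      using zero[of "(0, b)" for b] u by (intro dual_eqI) (auto simp: double_form_def)
    moreover have "snd u = 0"
      using zero[of "(y, 0)" for y] by (auto simp: double_form_def split_beta fun_eq_iff)
    ultimately show "u = 0" by (simp add: prod_eq_iff)
  next
    fix u v w :: "'a \<times> ('a \<Rightarrow> 'k)"
    assume "u \<in> UNIV \<times> D" "v \<in> UNIV \<times> D" "w \<in> UNIV \<times> D"
    \<comment> \<open>Once paired, all terms are values of the two products, and they
      cancel.\<close>
    then show "double_form (double u v) w + double_form v (double u w - double w u) = 0"
      by (auto simp: double_form_def double_mul_def dual_rep_simps pairing algebra_simps)
  qed (auto simp: double_form_def double_mul_def linear_on_def prod_scale_def inj_on_def Pt_apply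
      dual_rep_simps zero_prod_def)
qed

lemma manin_imp_compatible:
  assumes manin
  shows compatible
proof -
  interpret averaging_manin_triple "prod_scale scale dual_scale" "UNIV \<times> D" double "map_prod P Pt"
    double_form scale UNIV mul P dual_scale D muld Pt "\<lambda>x. (x, 0)" "\<lambda>\<xi>. (0, \<xi>)"
    by (rule assms)
  show ?thesis
    unfolding compatible_def
  proof (intro allI ballI conjI)
    fix x y a b assume ab: "a \<in> D" "b \<in> D"
    show "cocycle1 x y a b = 0"
      \<comment> \<open>The cocycle becomes a component of the pre-Lie defect; with
        \<open>snd_diff\<close> removed the difference stays whole and the identity reduces it to
        0.\<close>
      unfolding double_cocycle1[OF ab, symmetric]
      using pre_lie[of "(x, 0)" "(0, a)" "(0, b)"] ab by (simp del: snd_diff)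
    show "cocycle2 x y a b = 0"
      unfolding double_cocycle2[OF ab, symmetric]
      using pre_lie[of "(0, a)" "(0, b)" "(y, 0)"] ab by (simp del: snd_diff)
  qed
qed

end


section \<open>The dual coproduct\<close>

locale dual_coproduct = dual_averaging_pair scale mul muld P
  for scale :: "'k::field_char_0 \<Rightarrow> 'a::ab_group_add \<Rightarrow> 'a"
    and mul  (infixl "\<odot>" 70) and muld  (infixl "\<bullet>" 70) and P +
  fixes \<Delta> :: "'a \<Rightarrow> ('a, 'k) tensor2"
  assumes coproduct_tensor: "\<Delta> x \<in> tensor2 scale"
    and coproduct_pairing: "a \<in> dual scale \<Longrightarrow> b \<in> dual scale \<Longrightarrow>
      tensor_pairing a b (\<Delta> x) = (a \<bullet> b) x"
begin

text \<open>Tensors vanish off the dual by their encoding, so the pairing determines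
  \<open>\<Delta>\<close> as a function.\<close>

lemma coproduct_apply: "\<Delta> x a b = (if a \<in> D \<and> b \<in> D then (a \<bullet> b) x else 0)"
  using coproduct_pairing[of a b x] tensor2_outside_dual[OF coproduct_tensor, of a b x]
  by (auto simp: tensor_pairing_def)

text \<open>A tensor map acts on values by precomposing the functionals, that is, through
  transposes.\<close>

lemma tensor_map_mult:
  assumes "a \<in> D" "b \<in> D"
  shows "tensor_map scale (left_mult mul x) id t a b = t (lact x a) b"
    and "tensor_map scale id (left_mult mul x) t a b = t a (lact x b)"
    and "tensor_map scale id (right_mult mul x) t a b = t a (ract x b)"
    and "tensor_map scale id (left_mult mul x - right_mult mul x) t a b = t a (lact x b - ract x b)"
  using assms
  by (simp_all add: tensor_map_def lact_def ract_def left_mult_def right_mult_def fun_diff_def)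

lemma tensor_map_outside: "a \<notin> D \<or> b \<notin> D \<Longrightarrow> tensor_map scale f g t a b = 0"
  by (auto simp: tensor_map_def)

lemma tensor_map_P:
  assumes "a \<in> D" "b \<in> D"
  shows "tensor_map scale P P t a b = t (Pt a) (Pt b)"
    and "tensor_map scale P id t a b = t (Pt a) b"
    and "tensor_map scale id P t a b = t a (Pt b)"
  using assms by (simp_all add: tensor_map_def transpose_map_def)

lemma co_averaging:
  "tensor_map scale P P (\<Delta> x) = tensor_map scale P id (\<Delta> (P x))"
  "tensor_map scale P P (\<Delta> x) = tensor_map scale id P (\<Delta> (P x))"
proof -
  have "tensor_map scale P P (\<Delta> x) a b = tensor_map scale P id (\<Delta> (P x)) a b \<and>
    tensor_map scale P P (\<Delta> x) a b = tensor_map scale id P (\<Delta> (P x)) a b" for a b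
    by (cases "a \<in> D \<and> b \<in> D")
      (auto simp: tensor_map_P tensor_map_outside coproduct_apply muld_P)
  then show "tensor_map scale P P (\<Delta> x) = tensor_map scale P id (\<Delta> (P x))"
    "tensor_map scale P P (\<Delta> x) = tensor_map scale id P (\<Delta> (P x))"
    unfolding fun_eq_iff by blast+
qed

text \<open>The coalgebra identity, paired with three functionals, is the pre-Lie identity of
  \<open>muld\<close>; the coaveraging laws are those of \<open>Pt\<close>.\<close>

lemma averaging_coalgebra: "averaging_pre_lie_coalgebra scale \<Delta> P"
proof unfold_locales
  show "linear_on scale tensor2_scale UNIV (tensor2 scale) \<Delta>"
    by (auto simp: linear_on_def coproduct_tensor coproduct_apply fun_eq_iff fun_scale_def)
  show "linear_on scale scale UNIV UNIV P" by (rule A.P_linear)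
  fix x
  \<comment> \<open>Iterated coproducts pair with this functional, which is again an element of the
    dual.\<close>
  have fold: "(\<lambda>v. \<Delta> v a b) = a \<bullet> b" if "a \<in> D" "b \<in> D" for a b
    using that by (simp add: coproduct_apply)
  show "coprod_left scale \<Delta> (\<Delta> x) - coprod_right scale \<Delta> (\<Delta> x) =
      flip12 (coprod_left scale \<Delta> (\<Delta> x) - coprod_right scale \<Delta> (\<Delta> x))" (is "?l = ?r")
  proof (intro ext)
    fix a b c
    show "?l a b c = ?r a b c"
    proof (cases "a \<in> D \<and> b \<in> D \<and> c \<in> D")
      case True
      then show ?thesis
        using dual_pre_lie_apply[of a b c x]
        by (simp add: flip12_def coprod_left_def coprod_right_def fold coproduct_apply)
    qed (auto simp: flip12_def coprod_left_def coprod_right_def)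
  qed
qed (fact co_averaging)+

text \<open>The case distinction covers arguments off the dual, because tensors are compared as
  functions.\<close>

lemma compat1_cocycle:
  "(\<Delta> (x \<odot> y - y \<odot> x) -
    ((tensor_map scale (left_mult mul x) id (\<Delta> y)
        + tensor_map scale id (left_mult mul x - right_mult mul x) (\<Delta> y))
      - (tensor_map scale (left_mult mul y) id (\<Delta> x)
        + tensor_map scale id (left_mult mul y - right_mult mul y) (\<Delta> x)))) a b
    = (if a \<in> D \<and> b \<in> D then cocycle1 x y a b else 0)"
  by (cases "a \<in> D \<and> b \<in> D")
    (auto simp: tensor_map_mult tensor_map_outside coproduct_apply cocycle1_def)

lemma compat2_cocycle:
  "(\<Delta> (x \<odot> y) - flip (\<Delta> (x \<odot> y)) -
    (let t = tensor_map scale id (right_mult mul y) (\<Delta> x)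
          + (tensor_map scale (left_mult mul x) id (\<Delta> y)
            + tensor_map scale id (left_mult mul x) (\<Delta> y))
     in t - flip t)) a b
    = (if a \<in> D \<and> b \<in> D then cocycle2 x y a b else 0)"
  by (cases "a \<in> D \<and> b \<in> D")
    (auto simp: tensor_map_mult tensor_map_outside coproduct_apply cocycle2_def flip_def Let_def)

lemma bialgebra_iff: "averaging_pre_lie_bialgebra scale mul \<Delta> P P \<longleftrightarrow> compatible"
proof
  assume "averaging_pre_lie_bialgebra scale mul \<Delta> P P"
  then interpret B: averaging_pre_lie_bialgebra scale mul \<Delta> P P .
  show compatible
    unfolding compatible_def
  proof (intro allI ballI conjI)
    fix x y a b assume "a \<in> D" "b \<in> D"
    then show "cocycle1 x y a b = 0" "cocycle2 x y a b = 0"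
      using compat1_cocycle[of x y a b] compat2_cocycle[of x y a b]
      unfolding B.compat1 B.compat2 by simp_all
  qed
next
  assume compatible
  then have c: "a \<in> D \<and> b \<in> D \<Longrightarrow> cocycle1 x y a b = 0" "a \<in> D \<and> b \<in> D \<Longrightarrow> cocycle2 x y a b = 0"
    for x y a b by (auto simp: compatible_def)
  interpret C: averaging_pre_lie_coalgebra scale \<Delta> P by (rule averaging_coalgebra)
  show "averaging_pre_lie_bialgebra scale mul \<Delta> P P"
  proof unfold_locales
    fix x y
    show "\<Delta> (x \<odot> y - y \<odot> x) =
      (tensor_map scale (left_mult mul x) id (\<Delta> y)
        + tensor_map scale id (left_mult mul x - right_mult mul x) (\<Delta> y))
      - (tensor_map scale (left_mult mul y) id (\<Delta> x)
        + tensor_map scale id (left_mult mul y - right_mult mul y) (\<Delta> x))"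
      \<comment> \<open>Equality is replaced by a vanishing difference, the form to which
        \<open>compat1_cocycle\<close> applies.\<close>
      unfolding eq_iff_diff_eq_0[of "\<Delta> (x \<odot> y - y \<odot> x)"]
      by (intro ext) (simp only: compat1_cocycle c if_cancel zero_fun_apply cong: if_cong)
    show "\<Delta> (x \<odot> y) - flip (\<Delta> (x \<odot> y)) =
      (let t = tensor_map scale id (right_mult mul y) (\<Delta> x)
          + (tensor_map scale (left_mult mul x) id (\<Delta> y)
            + tensor_map scale id (left_mult mul x) (\<Delta> y))
       in t - flip t)"
      unfolding eq_iff_diff_eq_0[of "\<Delta> (x \<odot> y) - flip (\<Delta> (x \<odot> y))"]
      by (intro ext) (simp only: compat2_cocycle c if_cancel zero_fun_apply cong: if_cong)
  \<comment> \<open>With \<open>S = P\<close> the mixed conditions are the averaging laws of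
    \<open>A\<close> and the coaveraging laws of \<open>\<Delta>\<close>.\<close>
  qed (auto simp: A.averaging_left[symmetric] A.averaging_right[symmetric] co_averaging[symmetric])
qed

end

theorem corollary3p7:
  fixes scale :: "'k::field_char_0 \<Rightarrow> 'a::ab_group_add \<Rightarrow> 'a"
    and mul :: "'a \<Rightarrow> 'a \<Rightarrow> 'a"
    and muld :: "('a \<Rightarrow> 'k) \<Rightarrow> ('a \<Rightarrow> 'k) \<Rightarrow> 'a \<Rightarrow> 'k"
    and P :: "'a \<Rightarrow> 'a"
    and \<Delta> :: "'a \<Rightarrow> ('a, 'k) tensor2"
  assumes A: "averaging_pre_lie_algebra scale UNIV mul P"
    and A_dual: "averaging_pre_lie_algebra dual_scale (dual scale) muld (transpose_map P)"
    and Delta_tensor: "\<And>x. \<Delta> x \<in> tensor2 scale"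
    and Delta_pairing: "\<And>x \<xi> \<eta>. \<xi> \<in> dual scale \<Longrightarrow> \<eta> \<in> dual scale \<Longrightarrow>
      tensor_pairing \<xi> \<eta> (\<Delta> x) = muld \<xi> \<eta> x"
  shows
    "(averaging_pre_lie_bialgebra scale mul \<Delta> P P \<longleftrightarrow>
      averaging_matched_pair
        scale UNIV mul P
        dual_scale (dual scale) muld (transpose_map P)
        (dual_rep (left_mult mul) - dual_rep (right_mult mul))
        (- dual_rep (right_mult mul))
        (codual_rep scale (left_mult muld) - codual_rep scale (right_mult muld))
        (- codual_rep scale (right_mult muld)))
    \<and> (averaging_pre_lie_bialgebra scale mul \<Delta> P P \<longleftrightarrow>
      averaging_manin_triple
        (prod_scale scale dual_scale) (UNIV \<times> dual scale) (double_mul scale mul muld)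
        (map_prod P (transpose_map P)) double_form
        scale UNIV mul P
        dual_scale (dual scale) muld (transpose_map P)
        (\<lambda>x. (x, 0)) (\<lambda>\<xi>. (0, \<xi>)))"
proof -
  interpret dual_coproduct scale mul muld P \<Delta>
    by (intro dual_coproduct.intro dual_averaging_pair.intro dual_coproduct_axioms.intro assms)
  show ?thesis
    using bialgebra_iff matched_pair_iff compatible_imp_manin manin_imp_compatible by blast
qed

end
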